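(* Let $m,r,b>0$, $0<D_0\le D_1$, $T<\infty$, and let $W$ be a standard Brownian motion. For $\epsilon>0$ let $(q^\epsilon,\sigma^\epsilon)$ be defined on $[0,T]$ by $q^\epsilon(0)=0$, $\sigma^\epsilon(0)=0$, $$dq^\epsilon(t)=\begin{cases} m\,dt+D_0\,dW_t & \text{if } \sigma^\epsilon(t)=0,\\ -\tfrac{r}{\epsilon}\,dt+D_1\,dW_t & \text{if } \sigma^\epsilon(t)=r/\epsilon,\end{cases}$$ where $\sigma^\epsilon$ takes values in $\{0,r/\epsilon\}$, switches from $0$ to $r/\epsilon$ when $q^\epsilon$ hits $b$ and back to $0$ when $q^\epsilon$ next hits $0$, repeatedly (extend $\sigma^\epsilon$ by $0$ for $t>T$). Let $E_t$ solve $dE_t=m\,dt+D_0\,dW_t$, $E_0=0$ (same $W$), let $\tau_k^d=\inf\{t>0: E(t)=kb\}$ for $k\in\mathbb{N}$, let $\mathcal{N}(T)$ be the number of $k$ with $\tau_k^d\le T$, and define the point process $$\sigma(t)=b\sum_{i=1}^{\mathcal{N}(T)}\delta(t-\tau_i^d).$$ Then for every test function $\phi\in C_c^\infty(0,\infty)$, $$\lim_{\epsilon\to0}\mathbb{E}\left[\left|\langle\sigma^\epsilon,\phi\rangle-\langle\sigma,\phi\rangle\right|^2\right]=0,\qquad\text{where }\langle f,g\rangle=\int_0^\infty f(t)g(t)\,dt$$ (so $\langle\sigma,\phi\rangle=b\sum_{i=1}^{\mathcal{N}(T)}\phi(\tau_i^d)$). *)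

theory Defs
  imports "HOL-Probability.Probability"
begin

definition brownian_motion :: "'a measure \<Rightarrow> (real \<Rightarrow> 'a \<Rightarrow> real) \<Rightarrow> bool" where
  "brownian_motion M W \<longleftrightarrow> prob_space M \<and>
     (\<forall>\<omega>\<in>space M. W 0 \<omega> = 0 \<and> continuous_on {0..} (\<lambda>t. W t \<omega>)) \<and>
     (\<forall>s t. 0 \<le> s \<and> s < t \<longrightarrow>
        distributed M lborel (\<lambda>\<omega>. W t \<omega> - W s \<omega>)
          (\<lambda>x. ennreal (normal_density 0 (sqrt (t - s)) x))) \<and>
     (\<forall>(n::nat) (ts::nat \<Rightarrow> real). 0 \<le> ts 0 \<and> strict_mono ts \<longrightarrow>
        prob_space.indep_vars M (\<lambda>_. borel) (\<lambda>i \<omega>. W (ts (Suc i)) \<omega> - W (ts i) \<omega>) {..<n})"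

definition test_fun_pos :: "(real \<Rightarrow> real) \<Rightarrow> bool" where
  "test_fun_pos \<phi> \<longleftrightarrow> (\<forall>k x. ((deriv ^^ k) \<phi>) differentiable (at x)) \<and>
     (\<exists>a c. 0 < a \<and> a \<le> c \<and> (\<forall>x. x \<notin> {a..c} \<longrightarrow> \<phi> x = 0))"

text \<open>Pathwise characterisation of the switched SDE for (q^eps, sigma^eps) driven by the
  Brownian path w, on [0,T]; sigma^eps is extended by 0 for t > T.
  sigma(t) = r/eps iff q has hit b at some time s <= t and has not hit 0 during [s,t]
  (switch to r/eps at hitting b, back to 0 at the next hitting of 0).  On every time interval
  on which sigma is constant, the increment of q is drift * dt + D * dW.\<close>
definition switching_solution ::
  "real \<Rightarrow> real \<Rightarrow> real \<Rightarrow> real \<Rightarrow> real \<Rightarrow> real \<Rightarrow> real \<Rightarrow>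
   (real \<Rightarrow> real) \<Rightarrow> (real \<Rightarrow> real) \<Rightarrow> (real \<Rightarrow> real) \<Rightarrow> bool" where
  "switching_solution m r b D0 D1 T \<epsilon> w q \<sigma> \<longleftrightarrow>
     q 0 = 0 \<and> continuous_on {0..T} q \<and>
     (\<forall>t\<in>{0..T}. \<sigma> t =
        (if \<exists>s\<in>{0..t}. q s = b \<and> (\<forall>u\<in>{s..t}. q u \<noteq> 0) then r / \<epsilon> else 0)) \<and>
     (\<forall>t>T. \<sigma> t = 0) \<and>
     (\<forall>s t. 0 \<le> s \<and> s \<le> t \<and> t \<le> T \<and> (\<forall>u\<in>{s..<t}. \<sigma> u = 0) \<longrightarrow>
        q t - q s = m * (t - s) + D0 * (w t - w s)) \<and>
     (\<forall>s t. 0 \<le> s \<and> s \<le> t \<and> t \<le> T \<and> (\<forall>u\<in>{s..<t}. \<sigma> u = r / \<epsilon>) \<longrightarrow>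
        q t - q s = - (r / \<epsilon>) * (t - s) + D1 * (w t - w s))"

definition hit_time :: "(real \<Rightarrow> real) \<Rightarrow> real \<Rightarrow> real" where
  "hit_time e a = Inf {t. 0 < t \<and> e t = a}"

definition count_hits :: "(real \<Rightarrow> real) \<Rightarrow> real \<Rightarrow> real \<Rightarrow> nat" where
  "count_hits e b T = card {k::nat. 1 \<le> k \<and> hit_time e (real k * b) \<le> T}"

end

theory Submission
  imports Defs
begin

text \<open>Each burst \<open>[s, t)\<close> of \<open>\<sigma>\<^sup>\<epsilon>\<close> carries mass \<open>(r / \<epsilon>) (t - s) = b + D1 (W t - W s)\<close>, so its
  length is \<open>O(\<epsilon>)\<close> and its mass tends to \<open>b\<close>.  Between bursts \<open>q\<^sup>\<epsilon>\<close> moves like \<open>E\<close>, so the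
  \<open>k\<close>-th burst starts when \<open>E\<close> reaches a level that tends to \<open>k b\<close>.  Almost surely \<open>E\<close> exceeds
  \<open>k b\<close> immediately after hitting it, because the maximum of \<open>E\<close> over an interval has no atoms;
  hence the burst converges to \<open>\<tau>\<^sub>k\<close> and the pairings converge almost surely.

  For the \<open>L\<^sup>2\<close> bound, a chaining argument controls the modulus of continuity of \<open>W\<close> by a constant
  \<open>K\<close> with \<open>K\<^sup>8\<close> integrable.  Consecutive bursts are separated by an oscillation \<open>b\<close> of \<open>E\<close>, so
  there are \<open>O(K\<^sup>3)\<close> of them, each of mass \<open>O(K)\<close>, uniformly in \<open>\<epsilon>\<close>.\<close>

section \<open>Chaining\<close>

text \<open>The exponents fit together as follows. The pairing error is O(K^4), so its square needs
  K^8; this is why eighth moments of the increments of W are taken. The increments are compared with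
  2^-n on a grid of mesh proportional to 8^-n, which is Hoelder exponent 1/3: below 1/2, so the
  moments are summable over all grids, and such that an oscillation b of E takes a time of order
  K^-3 at least, whence the cubic count.

  \<open>q\<close> and \<open>sig\<close> are given path by path, without measurability in \<omega>.
  So every estimate on them is deterministic, in terms of the path of W alone, and the error is
  dominated by a measurable function of W.

  The hitting times and the number of hits by time T are not continuous functions of the path: a
  path that only touches the level k b, or reaches it exactly at time T, would spoil the limit. Both
  are null events. The former is treated without stopping times: touching makes k b the maximum over
  an interval with rational endpoints, which leaves countably many null events.\<close>

lemma chaining_modulus:
  fixes f :: "real \<Rightarrow> real" and K :: real
  assumes cont: "continuous_on {0..1} f"
    and incr: "\<And>n j. j < 8^n \<Longrightarrow> \<bar>f ((real j + 1) / 8^n) - f (real j / 8^n)\<bar> \<le> K / 2^n"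
    and xy: "x \<in> {0..1}" "y \<in> {0..1}" "\<bar>x - y\<bar> \<le> 1 / 8^n"
  shows "\<bar>f x - f y\<bar> \<le> 15 * K / 2^n"
proof -
  \<comment> \<open>Index of the point of the grid of mesh 8^-n at or just left of
    \<open>z\<close>.\<close>
  define a where "a z n = nat \<lfloor>8^n * z\<rfloor>" for z :: real and n :: nat
  have K: "0 \<le> K"
    using incr[of 0 0] by auto
  have a_le: "real (a z n) \<le> 8^n * z" "8^n * z < real (a z n) + 1" if "0 \<le> z" for z n
    using that by (auto simp: a_def)
  have a_ub: "a z n \<le> 8^n" if "z \<in> {0..1}" for z n
  proof -
    have "real (a z n) \<le> 8^n * z" using a_le that by auto
    also have "\<dots> \<le> 8^n" using that by auto
    finally show ?thesis by (metis of_nat_le_iff of_nat_numeral of_nat_power)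
  qed
  have walk: "\<bar>f (real (i + k) / 8^n) - f (real i / 8^n)\<bar> \<le> real k * (K / 2^n)"
    if "i + k \<le> 8^n" for i k n
    using that
  proof (induction k)
    case (Suc k)
    have "\<bar>f ((real (i + k) + 1) / 8^n) - f (real (i + k) / 8^n)\<bar> \<le> K / 2^n"
      using Suc.prems by (intro incr) auto
    moreover have "\<bar>f (real (i + k) / 8^n) - f (real i / 8^n)\<bar> \<le> real k * (K / 2^n)"
      using Suc by auto
    ultimately show ?case
      by (simp add: algebra_simps add_divide_distrib)
  qed auto
  \<comment> \<open>A cell of level \<open>n\<close> splits into 8 cells, so passing to the finer
    approximation of \<open>z\<close> takes at most 7 steps of the finer grid.\<close>
  have refine: "\<bar>f (real (a z (Suc n)) / 8^Suc n) - f (real (a z n) / 8^n)\<bar> \<le> 7 * K / 2^Suc n"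
    if z: "z \<in> {0..1}" for z n
  proof -
    have "real (8 * a z n) < real (a z (Suc n)) + 1" "real (a z (Suc n)) < real (8 * a z n + 8)"
      using a_le[of z n] a_le[of z "Suc n"] z by auto
    then have *: "8 * a z n \<le> a z (Suc n)" "a z (Suc n) - 8 * a z n \<le> 7"
      by linarith+
    have "\<bar>f (real (8 * a z n + (a z (Suc n) - 8 * a z n)) / 8^Suc n) - f (real (8 * a z n) / 8^Suc n)\<bar>
        \<le> real (a z (Suc n) - 8 * a z n) * (K / 2^Suc n)"
      using a_ub[OF z, of "Suc n"] * by (intro walk) auto
    also have "\<dots> \<le> 7 * (K / 2^Suc n)"
      using * K by (intro mult_right_mono) auto
    finally show ?thesis using * by simp
  qed
  \<comment> \<open>Written as a difference because 7 K / 2^(i+1) = 7 K / 2^i - 7 K / 2^(i+1), so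
    the geometric sum telescopes exactly.\<close>
  have tele: "\<bar>f (real (a z (n + k)) / 8^(n + k)) - f (real (a z n) / 8^n)\<bar> \<le> 7 * K / 2^n - 7 * K / 2^(n + k)"
    if z: "z \<in> {0..1}" for z n k
  proof (induction k)
    case (Suc k)
    have "7 * K / 2 ^ Suc (n + k) = 7 * K / 2 ^ (n+k) - 7 * K / 2 ^ Suc (n + k)"
      by (simp add: field_simps)
    then show ?case using refine[OF z, of "n + k"] Suc by simp
  qed auto
  have approx: "\<bar>f z - f (real (a z n) / 8^n)\<bar> \<le> 7 * K / 2^n" if z: "z \<in> {0..1}" for z n
  proof -
    have "(\<lambda>k. real (a z (n + k)) / 8^(n + k)) \<longlonglongrightarrow> z"
    proof (rule tendsto_sandwich)
      have "\<forall>k. z - 1 / 8^(n+k) \<le> real (a z (n + k)) / 8^(n + k)"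
      proof
        fix k
        have "8^(n+k) * z - 1 \<le> real (a z (n + k))"
          using a_le(2)[of z "n + k"] z by (simp add: less_imp_le)
        then have "(8^(n+k) * z - 1) / 8^(n+k) \<le> real (a z (n + k)) / 8^(n + k)"
          by (rule divide_right_mono) simp
        then show "z - 1 / 8^(n+k) \<le> real (a z (n + k)) / 8^(n + k)"
          by (simp add: diff_divide_distrib)
      qed
      then show "\<forall>\<^sub>F k in sequentially. z - (1/8)^n * (1/8)^k \<le> real (a z (n + k)) / 8^(n + k)"
        by (simp add: power_add power_one_over field_simps)
      show "\<forall>\<^sub>F k in sequentially. real (a z (n + k)) / 8^(n + k) \<le> z"
        using a_le(1) z by (auto simp: field_simps)
      have "(\<lambda>k. z - (1/8)^n * (1/8)^k) \<longlonglongrightarrow> z - (1/8)^n * 0"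
        by (intro tendsto_intros) auto
      then show "(\<lambda>k. z - (1/8)^n * (1/8)^k) \<longlonglongrightarrow> z" by simp
    qed auto
    then have lim: "(\<lambda>k. f (real (a z (n + k)) / 8^(n + k))) \<longlonglongrightarrow> f z"
    proof (rule continuous_on_tendsto_compose[OF cont _ z], intro always_eventually allI)
      fix k
      show "real (a z (n + k)) / 8^(n + k) \<in> {0..1}"
        using a_ub[OF z, of "n + k"] by (auto simp: divide_le_eq)
    qed
    have "\<bar>f (real (a z (n + k)) / 8^(n + k)) - f (real (a z n) / 8^n)\<bar> \<le> 7 * K / 2^n" for k
    proof -
      have "0 \<le> 7 * K / 2^(n+k)" using K by simp
      then show ?thesis using tele[OF z, of n k] by linarith
    qed
    then show ?thesis
      by (intro tendsto_le[OF _ tendsto_const tendsto_rabs[OF tendsto_diff[OF lim tendsto_const]]]) auto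
  qed
  \<comment> \<open>Points at distance at most 8^-n lie in the same cell or in neighbouring ones, so
    one grid step suffices.\<close>
  have near: "\<bar>f (real (a y n) / 8^n) - f (real (a x n) / 8^n)\<bar> \<le> K / 2^n"
    if "x \<in> {0..1}" "y \<in> {0..1}" "\<bar>x - y\<bar> \<le> 1 / 8^n" "a x n \<le> a y n" for x y
  proof -
    have "8^n * y - 8^n * x \<le> 1"
      using that(3) by (simp add: field_simps abs_le_iff)
    then have "real (a y n) < real (a x n) + 2"
      using a_le(1)[of y n] a_le(2)[of x n] that(1,2) by auto
    then have "a y n - a x n \<le> 1" by linarith
    moreover have "\<bar>f (real (a x n + (a y n - a x n)) / 8^n) - f (real (a x n) / 8^n)\<bar>
        \<le> real (a y n - a x n) * (K / 2^n)"
      using a_ub[OF that(2), of n] that(4) by (intro walk) auto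
    moreover have "real (a y n - a x n) * (K / 2^n) \<le> 1 * (K / 2^n)"
      using calculation(1) K by (intro mult_right_mono) auto
    ultimately show ?thesis using that(4) by simp
  qed
  have "\<bar>f (real (a y n) / 8^n) - f (real (a x n) / 8^n)\<bar> \<le> K / 2^n"
    using near[of x y] near[of y x] xy by (cases "a x n \<le> a y n") (auto simp: abs_minus_commute)
  \<comment> \<open>The constant 15 is 7 + 1 + 7: descend from \<open>x\<close> to its grid point,
    take one grid step, climb to \<open>y\<close>.\<close>
  then have "\<bar>f x - f y\<bar> \<le> 7 * K / 2^n + K / 2^n + 7 * K / 2^n"
    using approx[OF xy(1), of n] approx[OF xy(2), of n] by linarith
  also have "\<dots> = 15 * K / 2^n" by (simp add: field_simps)
  finally show ?thesis .
qed

section \<open>Switching paths\<close>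

text \<open>All times are truncated at \<open>T\<close>: a level that is not reached any more gives the value \<open>T\<close>,
  so the sequences of switching times below are eventually constant \<open>T\<close>.  Indices start at \<open>0\<close>:
  the \<open>k\<close>-th burst is \<open>[up_time (k - 1), down_time k)\<close>.\<close>

definition first_hit :: "(real \<Rightarrow> real) \<Rightarrow> real \<Rightarrow> real \<Rightarrow> real \<Rightarrow> real" where
  "first_hit f T u a = Inf (insert T {t \<in> {u..T}. f t = a})"

text \<open>The set is closed by continuity, and contains \<open>T\<close>, so the infimum is
  attained: it is a genuine hit unless it equals \<open>T\<close>.\<close>

lemma
  assumes "continuous_on {u..T} f" "u \<le> T"
  shows first_hit_ge: "u \<le> first_hit f T u a"
    and first_hit_le: "first_hit f T u a \<le> T"
    and first_hit_eq: "first_hit f T u a < T \<Longrightarrow> f (first_hit f T u a) = a"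
    and before_first_hit: "u \<le> x \<Longrightarrow> x < first_hit f T u a \<Longrightarrow> f x \<noteq> a"
proof -
  let ?S = "insert T {t \<in> {u..T}. f t = a}"
  have "closed {t \<in> {u..T}. f t = a}"
    using continuous_closed_preimage[OF assms(1), of "{a}"]
    by (simp add: vimage_def Int_def)
  then have cl: "closed ?S" by (rule closed_insert)
  have bd: "bdd_below ?S" using assms(2) by (auto intro!: bdd_belowI[of _ u])
  have mem: "first_hit f T u a \<in> ?S"
    unfolding first_hit_def using cl bd by (intro closed_contains_Inf) auto
  show "u \<le> first_hit f T u a" "first_hit f T u a \<le> T"
    "first_hit f T u a < T \<Longrightarrow> f (first_hit f T u a) = a"
    using mem assms(2) by auto
  show "f x \<noteq> a" if "u \<le> x" "x < first_hit f T u a"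
  proof
    assume "f x = a"
    then have "x \<in> ?S" using that \<open>first_hit f T u a \<le> T\<close> by auto
    then have "first_hit f T u a \<le> x"
      unfolding first_hit_def by (rule cInf_lower[OF _ bd])
    then show False using that by simp
  qed
qed

primrec down_time :: "(real \<Rightarrow> real) \<Rightarrow> real \<Rightarrow> real \<Rightarrow> nat \<Rightarrow> real" where
  "down_time q b T 0 = 0"
| "down_time q b T (Suc k) = first_hit q T (first_hit q T (down_time q b T k) b) 0"

definition up_time :: "(real \<Rightarrow> real) \<Rightarrow> real \<Rightarrow> real \<Rightarrow> nat \<Rightarrow> real" where
  "up_time q b T k = first_hit q T (down_time q b T k) b"

section \<open>Switching times and bursts of a single path, for one value of \<epsilon>\<close>

locale switching_path =
  fixes m r b D0 D1 T \<epsilon> :: real and w q \<sigma> :: "real \<Rightarrow> real"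
  assumes r: "0 < r" and b: "0 < b" and T: "0 \<le> T" and \<epsilon>: "0 < \<epsilon>"
    and sol: "switching_solution m r b D0 D1 T \<epsilon> w q \<sigma>"
begin

abbreviation "dn \<equiv> down_time q b T"
abbreviation "up \<equiv> up_time q b T"

lemma q_cont: "continuous_on {0..T} q" and q_0: "q 0 = 0"
  using sol by (auto simp: switching_solution_def)

lemma sigma_eq:
  "t \<in> {0..T} \<Longrightarrow>
    \<sigma> t = (if \<exists>s\<in>{0..t}. q s = b \<and> (\<forall>u\<in>{s..t}. q u \<noteq> 0) then r / \<epsilon> else 0)"
  using sol by (auto simp: switching_solution_def)

lemma sigma_after: "T < t \<Longrightarrow> \<sigma> t = 0"
  using sol by (auto simp: switching_solution_def)

lemma dn_bounds: "0 \<le> dn k \<and> dn k \<le> T"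
proof (induction k)
  case (Suc k)
  have 1: "continuous_on {dn k..T} q"
    using Suc by (intro continuous_on_subset[OF q_cont]) auto
  have 2: "dn k \<le> up k" "up k \<le> T"
    using first_hit_ge[OF 1] first_hit_le[OF 1] Suc by (auto simp: up_time_def)
  then have 3: "continuous_on {up k..T} q"
    using Suc by (intro continuous_on_subset[OF q_cont]) auto
  show ?case
    using first_hit_ge[OF 3 2(2), of 0] first_hit_le[OF 3 2(2), of 0] Suc 2
    by (simp flip: up_time_def)
qed (use T in auto)

lemma dn_cont: "continuous_on {dn k..T} q"
  using dn_bounds[of k] by (intro continuous_on_subset[OF q_cont]) auto

lemma dn_le_up: "dn k \<le> up k" and up_le: "up k \<le> T"
  using first_hit_ge[OF dn_cont] first_hit_le[OF dn_cont] dn_bounds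
  by (auto simp: up_time_def)

lemma up_cont: "continuous_on {up k..T} q"
  using dn_bounds[of k] dn_le_up[of k] by (intro continuous_on_subset[OF q_cont]) auto

lemma up_le_dn: "up k \<le> dn (Suc k)"
  using first_hit_ge[OF up_cont up_le] by (simp add: up_time_def)

lemma up_nonneg: "0 \<le> up k"
  using dn_bounds[of k] dn_le_up[of k] by simp

lemma q_up: "up k < T \<Longrightarrow> q (up k) = b"
  using first_hit_eq[OF dn_cont] dn_bounds by (simp add: up_time_def)

lemma q_dn: "dn k < T \<Longrightarrow> q (dn k) = 0"
  using first_hit_eq[OF up_cont up_le, of "k - 1" 0] q_0
  by (cases k) (auto simp: up_time_def)

lemma q_before_up: "dn k \<le> x \<Longrightarrow> x < up k \<Longrightarrow> q x \<noteq> b"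
  using before_first_hit[OF dn_cont] dn_bounds by (simp add: up_time_def)

lemma q_before_dn: "up k \<le> x \<Longrightarrow> x < dn (Suc k) \<Longrightarrow> q x \<noteq> 0"
  using before_first_hit[OF up_cont up_le] by (simp add: up_time_def)

text \<open>A witness \<open>s\<close> for the active state must come after \<open>dn k\<close>,
  where \<open>q\<close> vanishes, but \<open>q\<close> avoids \<open>b\<close> on
  \<open>[dn k, up k)\<close>.\<close>

lemma sigma_off: "dn k \<le> u \<Longrightarrow> u < up k \<Longrightarrow> \<sigma> u = 0"
proof -
  assume u: "dn k \<le> u" "u < up k"
  have "\<not> (\<exists>s\<in>{0..u}. q s = b \<and> (\<forall>v\<in>{s..u}. q v \<noteq> 0))"
  proof
    assume "\<exists>s\<in>{0..u}. q s = b \<and> (\<forall>v\<in>{s..u}. q v \<noteq> 0)"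
    then obtain s where s: "0 \<le> s" "s \<le> u" "q s = b" "\<And>v. s \<le> v \<Longrightarrow> v \<le> u \<Longrightarrow> q v \<noteq> 0"
      by auto
    have "dn k < T" using u up_le[of k] by simp
    then have "q (dn k) = 0" by (rule q_dn)
    then have "dn k \<le> s" using s(4)[of "dn k"] u by force
    then show False using q_before_up[of k s] s u by auto
  qed
  then show ?thesis
    using sigma_eq[of u] u dn_bounds[of k] up_le[of k] by auto
qed

lemma sigma_on: "up k \<le> u \<Longrightarrow> u < dn (Suc k) \<Longrightarrow> \<sigma> u = r / \<epsilon>"
proof -
  assume u: "up k \<le> u" "u < dn (Suc k)"
  have "up k < T" using u dn_bounds[of "Suc k"] by linarith
  then have "q (up k) = b" by (rule q_up)
  moreover have "\<forall>v\<in>{up k..u}. q v \<noteq> 0" using q_before_dn[of k] u by auto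
  ultimately have "\<exists>s\<in>{0..u}. q s = b \<and> (\<forall>v\<in>{s..u}. q v \<noteq> 0)"
    using up_nonneg[of k] u by (intro bexI[of _ "up k"]) auto
  then show ?thesis
    using sigma_eq[of u] u up_nonneg[of k] dn_bounds[of "Suc k"] by auto
qed

lemma q_off:
  assumes "dn k \<le> x" "x \<le> up k"
  shows "q x - q (dn k) = m * (x - dn k) + D0 * (w x - w (dn k))"
proof -
  have "\<forall>u\<in>{dn k..<x}. \<sigma> u = 0" using sigma_off[of k] assms by auto
  then show ?thesis
    using sol assms dn_bounds[of k] up_le[of k] by (auto simp: switching_solution_def)
qed

lemma q_on: "q (dn (Suc k)) - q (up k)
    = - (r / \<epsilon>) * (dn (Suc k) - up k) + D1 * (w (dn (Suc k)) - w (up k))"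
proof -
  have "\<forall>u\<in>{up k..<dn (Suc k)}. \<sigma> u = r / \<epsilon>" using sigma_on[of k] by auto
  then show ?thesis
    using sol dn_bounds[of "Suc k"] up_nonneg[of k] up_le_dn[of k]
    unfolding switching_solution_def by blast
qed

text \<open>Matters when \<open>dn (Suc k) = T\<close> cuts a burst short, so that \<open>q\<close>
  may be nonzero there. Starting from \<open>b\<close>, \<open>q\<close> cannot become negative
  without an earlier zero.\<close>

lemma q_dn_nonneg:
  assumes "up k < T"
  shows "0 \<le> q (dn (Suc k))"
proof (rule ccontr)
  assume neg: "\<not> 0 \<le> q (dn (Suc k))"
  have "continuous_on {up k..dn (Suc k)} q"
    using dn_bounds[of "Suc k"] by (intro continuous_on_subset[OF up_cont]) auto
  then obtain x where x: "up k \<le> x" "x \<le> dn (Suc k)" "q x = 0"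
    using IVT2'[of q "dn (Suc k)" 0 "up k"] neg q_up[OF assms] b up_le_dn[of k] by auto
  then have "x = dn (Suc k)" using q_before_dn[of k x] by force
  then show False using x neg by simp
qed

lemma burst_mass_eq:
  assumes "dn (Suc k) < T"
  shows "r / \<epsilon> * (dn (Suc k) - up k) = b + D1 * (w (dn (Suc k)) - w (up k))"
  using q_on[of k] q_dn[OF assms] q_up[of k] up_le_dn[of k] assms by auto

text \<open>Only an inequality, because \<open>T\<close> may interrupt the burst;
  \<open>q_dn_nonneg\<close> replaces the missing return to 0. An increment of \<open>w\<close>
  costs at most \<open>2 * X\<close>.\<close>

lemma burst_mass_le:
  assumes "0 \<le> D1" and X: "\<And>x. x \<in> {0..T} \<Longrightarrow> \<bar>w x\<bar> \<le> X"
  shows "r / \<epsilon> * (dn (Suc k) - up k) \<le> b + 2 * D1 * X"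
proof (cases "up k < T")
  case True
  have "w (dn (Suc k)) - w (up k) \<le> 2 * X"
    using X[of "dn (Suc k)"] X[of "up k"] dn_bounds[of "Suc k"] up_nonneg[of k] up_le[of k]
    by (auto simp: abs_le_iff)
  then have "D1 * (w (dn (Suc k)) - w (up k)) \<le> D1 * (2 * X)"
    using assms(1) by (intro mult_left_mono)
  then show ?thesis using q_on[of k] q_dn_nonneg[OF True] q_up[OF True] by simp
next
  case False
  then have "dn (Suc k) = up k"
    using dn_bounds[of "Suc k"] up_le_dn[of k] by linarith
  moreover have "0 \<le> X" using X[of 0] T by force
  ultimately show ?thesis using b assms(1) by simp
qed

text \<open>From \<open>dn k\<close> to a proper \<open>up k\<close> the process climbs from 0 to
  \<open>b\<close> with the dynamics of the energy, which takes longer than \<delta>. Counting from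
  0, \<open>Suc n\<close> such climbs precede the end of phase \<open>n\<close>, and there is no
  time for them.\<close>

lemma up_eq_T:
  assumes modulus: "\<And>x y. x \<in> {0..T} \<Longrightarrow> y \<in> {0..T} \<Longrightarrow> \<bar>x - y\<bar> \<le> \<delta> \<Longrightarrow>
      \<bar>m * (x - y) + D0 * (w x - w y)\<bar> < b"
    and n: "T \<le> real (Suc n) * \<delta>"
  shows "up n = T"
proof -
  have step: "dn k + \<delta> < up k" if "up k < T" for k
  proof (rule ccontr)
    assume "\<not> dn k + \<delta> < up k"
    then have "\<bar>m * (up k - dn k) + D0 * (w (up k) - w (dn k))\<bar> < b"
      using dn_bounds[of k] dn_le_up[of k] up_le[of k] by (intro modulus) auto
    then have "\<bar>q (up k) - q (dn k)\<bar> < b" using q_off[of k "up k"] dn_le_up[of k] by simp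
    then show False using q_up[OF that] q_dn[of k] dn_le_up[of k] that by auto
  qed
  have "up k < T \<Longrightarrow> real (Suc k) * \<delta> < up k" for k
  proof (induction k)
    case 0
    then show ?case using step[of 0] by simp
  next
    case (Suc k)
    have "up k \<le> dn (Suc k)" "dn (Suc k) \<le> up (Suc k)" by (rule up_le_dn dn_le_up)+
    with Suc step[of "Suc k"] show ?case by (simp add: algebra_simps)
  qed
  from this[of n] n up_le[of n] show ?thesis by linarith
qed

text \<open>Both claims go through one induction: in the last phase, the vanishing of the earlier
  indicators isolates the new one.\<close>

lemma sigma_sum:
  "t \<in> {0..<dn n} \<Longrightarrow> \<sigma> t = (\<Sum>k<n. r / \<epsilon> * indicator {up k..<dn (Suc k)} t)"
  "dn n \<le> t \<Longrightarrow> (\<Sum>k<n. r / \<epsilon> * indicator {up k..<dn (Suc k)} t) = 0"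
proof (induction n)
  case (Suc n)
  note le = dn_le_up[of n] up_le_dn[of n]
  {
    case 1
    show ?case
    proof (cases "t < dn n")
      case True
      then show ?thesis using Suc.IH(1) 1 le by (simp add: indicator_def)
    next
      case False
      then have "(\<Sum>k<n. r / \<epsilon> * indicator {up k..<dn (Suc k)} t) = 0" using Suc.IH(2) by simp
      then show ?thesis using sigma_off[of n t] sigma_on[of n t] 1 False
        by (cases "t < up n") (auto simp: indicator_def)
    qed
  next
    case 2
    then show ?case using Suc.IH(2) le by (simp add: indicator_def)
  }
qed auto

lemma pairing_eq:
  assumes \<phi>: "continuous_on UNIV \<phi>" "\<And>t. t \<le> 0 \<Longrightarrow> \<phi> t = 0" and n: "up n = T"
  shows "(LBINT t:{0<..}. \<sigma> t * \<phi> t) = (\<Sum>k\<le>n. r / \<epsilon> * (LBINT t:{up k..<dn (Suc k)}. \<phi> t))"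
proof -
  have dnT: "dn (Suc n) = T" using n up_le_dn[of n] dn_bounds[of "Suc n"] by simp
  \<comment> \<open>The half-open bursts omit the point \<open>T\<close>, where \<sigma> may still
    be active; the extra term restores the identity pointwise and has integral 0.\<close>
  let ?g = "\<lambda>t. (\<Sum>k\<le>n. r / \<epsilon> * (indicat_real {up k..<dn (Suc k)} t * \<phi> t))
      + \<sigma> T * \<phi> T * indicat_real {T} t"
  have eq: "indicat_real {0<..} t * (\<sigma> t * \<phi> t) = ?g t" for t
  proof (cases "t \<le> 0")
    case True
    then show ?thesis using \<phi>(2)[of t] \<phi>(2)[of T] by (auto simp: indicator_def)
  next
    case False
    have sum: "(\<Sum>k\<le>n. r / \<epsilon> * (indicat_real {up k..<dn (Suc k)} t * \<phi> t))
        = (\<Sum>k<Suc n. r / \<epsilon> * indicat_real {up k..<dn (Suc k)} t) * \<phi> t"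
      by (simp only: sum_distrib_right lessThan_Suc_atMost mult.assoc)
    consider "t < T" | "t = T" | "T < t" by linarith
    then show ?thesis
    proof cases
      case 1
      then show ?thesis using False sigma_sum(1)[of t "Suc n"] dnT sum by simp
    next
      case 2
      then show ?thesis using False sigma_sum(2)[of "Suc n" t] dnT sum by simp
    next
      case 3
      then show ?thesis using False sigma_sum(2)[of "Suc n" t] dnT sum sigma_after[of t] by simp
    qed
  qed
  have int: "integrable lborel (\<lambda>t. indicat_real {x..<y} t * \<phi> t)" for x y
  proof -
    have "set_integrable lborel {x..y} \<phi>"
      by (rule borel_integrable_atLeastAtMost') (auto intro: continuous_on_subset[OF \<phi>(1)])
    then have "set_integrable lborel {x..<y} \<phi>"
      by (rule set_integrable_subset) auto
    then show ?thesis by (simp add: set_integrable_def)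
  qed
  have "(LBINT t:{0<..}. \<sigma> t * \<phi> t) = (\<integral>t. ?g t \<partial>lborel)"
    unfolding set_lebesgue_integral_def by (simp only: real_scaleR_def eq)
  also have "\<dots> = (\<Sum>k\<le>n. r / \<epsilon> * (\<integral>t. indicat_real {up k..<dn (Suc k)} t * \<phi> t \<partial>lborel))"
    using int by (subst Bochner_Integration.integral_add) auto
  finally show ?thesis by (simp add: set_lebesgue_integral_def)
qed

end

declare down_time.simps(2) [simp del]

section \<open>Hitting times of the energy\<close>

text \<open>Separates the mass of a burst from its location: the integral becomes length times a
  value of \<phi> inside the burst. The case \<open>u = v\<close> covers the empty bursts at
  \<open>T\<close>.\<close>

lemma LBINT_mean_value:
  fixes \<phi> :: "real \<Rightarrow> real"
  assumes "continuous_on {u..v} \<phi>" "u \<le> v"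
  obtains \<xi> where "\<xi> \<in> {u..v}" "(LBINT t:{u..<v}. \<phi> t) = (v - u) * \<phi> \<xi>"
proof (cases "u = v")
  case True
  then show ?thesis using that[of u] by (simp add: set_lebesgue_integral_def)
next
  case False
  then have uv: "u < v" using assms(2) by simp
  obtain x where x: "x \<in> {u..v}" "\<And>t. t \<in> {u..v} \<Longrightarrow> \<phi> x \<le> \<phi> t"
    using continuous_attains_inf[of "{u..v}" \<phi>] assms by auto
  obtain y where y: "y \<in> {u..v}" "\<And>t. t \<in> {u..v} \<Longrightarrow> \<phi> t \<le> \<phi> y"
    using continuous_attains_sup[of "{u..v}" \<phi>] assms by auto
  have "set_integrable lborel {u..v} \<phi>"
    by (rule borel_integrable_atLeastAtMost') (fact assms)
  then have int: "set_integrable lborel {u..<v} \<phi>"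
    by (rule set_integrable_subset) auto
  have cint: "set_integrable lborel {u..<v} (\<lambda>_. c)" for c :: real
    using uv by (auto simp: set_integrable_def)
  have const: "(LBINT t:{u..<v}. c) = (v - u) * c" for c :: real
    using uv by (simp add: set_lebesgue_integral_def)
  have "(v - u) * \<phi> x \<le> (LBINT t:{u..<v}. \<phi> t)"
    unfolding const[symmetric] using x int cint by (intro set_integral_mono) auto
  moreover have "(LBINT t:{u..<v}. \<phi> t) \<le> (v - u) * \<phi> y"
    unfolding const[symmetric] using y int cint by (intro set_integral_mono) auto
  ultimately have "(LBINT t:{u..<v}. \<phi> t) / (v - u) \<in> {\<phi> x..\<phi> y}"
    using uv by (simp add: field_simps)
  moreover have "connected (\<phi> ` {u..v})"
    by (intro connected_continuous_image assms) simp
  then have "{\<phi> x..\<phi> y} \<subseteq> \<phi> ` {u..v}"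
    using x(1) y(1) by (intro connected_contains_Icc) auto
  ultimately obtain \<xi> where "\<xi> \<in> {u..v}" "(LBINT t:{u..<v}. \<phi> t) / (v - u) = \<phi> \<xi>"
    by auto
  then show ?thesis using that[of \<xi>] uv by (simp add: field_simps)
qed

lemma
  fixes e :: "real \<Rightarrow> real"
  assumes "continuous_on {0..} e" "e 0 = 0" "0 < a" "\<exists>t>0. e t = a"
  shows hit_time_pos: "0 < hit_time e a"
    and at_hit_time: "e (hit_time e a) = a"
    and before_hit_time: "0 \<le> x \<Longrightarrow> x < hit_time e a \<Longrightarrow> e x < a"
proof -
  let ?S = "{t. 0 < t \<and> e t = a}"
  \<comment> \<open>As \<open>e 0 = 0 < a\<close>, the strict bound \<open>0 < t\<close> may be
    relaxed to \<open>0 \<le> t\<close>, which makes the set closed.\<close>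
  have S: "?S = {t \<in> {0..}. e t \<in> {a}}" using assms(2,3) by (auto simp: less_le)
  have "closed ({0..} \<inter> e -` {a})"
    by (rule continuous_closed_preimage[OF assms(1)]) auto
  then have "closed ?S" unfolding S by (simp add: vimage_def Int_def)
  moreover have bd: "bdd_below ?S" by (auto intro!: bdd_belowI[of _ 0])
  ultimately have "hit_time e a \<in> ?S"
    unfolding hit_time_def using assms(4) by (intro closed_contains_Inf) auto
  then show "0 < hit_time e a" "e (hit_time e a) = a" by auto
  show "e x < a" if x: "0 \<le> x" "x < hit_time e a"
  proof (rule ccontr)
    assume "\<not> e x < a"
    moreover have "continuous_on {0..x} e"
      by (rule continuous_on_subset[OF assms(1)]) auto
    ultimately obtain y where y: "0 \<le> y" "y \<le> x" "e y = a"
      using IVT'[of e 0 a x] assms(2,3) x(1) by auto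
    then have "y \<in> ?S" using assms(2,3) by (auto simp: less_le)
    then have "hit_time e a \<le> y" unfolding hit_time_def by (rule cInf_lower[OF _ bd])
    then show False using x y by simp
  qed
qed

lemma down_closed_eq_Icc_card:
  fixes S :: "nat set"
  assumes "finite S" "\<And>k. k \<in> S \<Longrightarrow> 1 \<le> k" "\<And>j k. k \<in> S \<Longrightarrow> 1 \<le> j \<Longrightarrow> j \<le> k \<Longrightarrow> j \<in> S"
  shows "S = {1..card S}"
proof (cases "S = {}")
  case False
  have S: "S = {1..Max S}"
  proof
    show "S \<subseteq> {1..Max S}" using assms(1,2) by auto
    show "{1..Max S} \<subseteq> S" using assms(3)[OF Max_in[OF assms(1) False]] by auto
  qed
  have "card S = card {1..Max S}" using S by (rule arg_cong)
  then show ?thesis using S by simp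
qed auto

text \<open>One path of the energy. \<open>levels_hit\<close>, which holds almost surely thanks to
  the positive drift, makes \<open>hit_time\<close> meaningful: it is an infimum, and that of an
  empty set carries no information.\<close>

locale energy_path =
  fixes m b D0 T :: real and w E :: "real \<Rightarrow> real"
  assumes b: "0 < b" and T: "0 \<le> T"
    and E_eq: "\<And>t. E t = m * t + D0 * w t"
    and w_cont: "continuous_on {0..} w" and w_0: "w 0 = 0"
    and levels_hit: "\<And>k. 1 \<le> k \<Longrightarrow> \<exists>t>0. E t = real k * b"
begin

definition "\<tau> k = hit_time E (real k * b)"

lemma E_cont: "continuous_on {0..} E"
proof -
  have "continuous_on {0..} (\<lambda>t. m * t + D0 * w t)"
    by (intro continuous_intros w_cont)
  then show ?thesis by (simp only: E_eq[abs_def])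
qed

lemma E_0: "E 0 = 0"
  by (simp add: E_eq w_0)

lemma
  assumes "1 \<le> k"
  shows tau_pos: "0 < \<tau> k" and E_tau: "E (\<tau> k) = real k * b"
    and E_before_tau: "0 \<le> x \<Longrightarrow> x < \<tau> k \<Longrightarrow> E x < real k * b"
proof -
  have a: "0 < real k * b" using assms b by simp
  note * = E_cont E_0 a levels_hit[OF assms]
  show "0 < \<tau> k" "E (\<tau> k) = real k * b"
    "0 \<le> x \<Longrightarrow> x < \<tau> k \<Longrightarrow> E x < real k * b"
    unfolding \<tau>_def by (fact hit_time_pos[OF *] at_hit_time[OF *] before_hit_time[OF *])+
qed

lemma tau_mono:
  assumes "1 \<le> j" "j < k"
  shows "\<tau> j < \<tau> k"
proof (rule ccontr)
  assume "\<not> \<tau> j < \<tau> k"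
  moreover have "E (\<tau> k) \<noteq> E (\<tau> j)" using assms b by (simp add: E_tau)
  ultimately have "\<tau> k < \<tau> j" by (metis linorder_neqE_linordered_idom)
  then have "E (\<tau> k) < real j * b" using assms tau_pos[of k] by (intro E_before_tau) auto
  then show False using assms b by (simp add: E_tau)
qed

text \<open>A path bounded above on \<open>[0, T]\<close> reaches finitely many levels, so
  \<open>card\<close> is a true count, and monotonicity of \<tau> makes the set an initial segment.
  The second bound is the value of \<open>E\<close> at its last hit.\<close>

lemma count_hits_set:
  assumes X: "\<And>x. x \<in> {0..T} \<Longrightarrow> E x \<le> X"
  shows "{k. 1 \<le> k \<and> \<tau> k \<le> T} = {1..count_hits E b T}"
    and "real (count_hits E b T) * b \<le> X"
proof -
  let ?S = "{k. 1 \<le> k \<and> \<tau> k \<le> T}"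
  have le: "real k * b \<le> X" if "k \<in> ?S" for k
    using X[of "\<tau> k"] tau_pos[of k] E_tau[of k] that by auto
  have "k \<le> nat \<lceil>X / b\<rceil>" if "k \<in> ?S" for k
  proof -
    have "real k \<le> X / b" using le[OF that] b by (simp add: field_simps)
    then show ?thesis using real_nat_ceiling_ge[of "X / b"] by linarith
  qed
  then have "finite ?S" by (intro finite_subset[of ?S "{..nat \<lceil>X / b\<rceil>}"]) auto
  then have "?S = {1..card ?S}"
  proof (rule down_closed_eq_Icc_card)
    fix j k assume "k \<in> ?S" "1 \<le> j" "j \<le> k"
    then show "j \<in> ?S" using tau_mono[of j k] by (cases "j = k") auto
  qed auto
  moreover have "card ?S = count_hits E b T" by (simp add: count_hits_def \<tau>_def)
  ultimately show eq: "?S = {1..count_hits E b T}" by simp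
  show "real (count_hits E b T) * b \<le> X"
  proof (cases "count_hits E b T = 0")
    case True
    then show ?thesis using X[of 0] T E_0 by simp
  next
    case False
    then have "count_hits E b T \<in> ?S" unfolding eq by auto
    then show ?thesis by (rule le)
  qed
qed

end

section \<open>Pathwise error bound and convergence\<close>

locale energy_path_family = energy_path +
  fixes r D1 :: real and q \<sigma> :: "real \<Rightarrow> real \<Rightarrow> real"
  assumes r: "0 < r" and D1: "0 \<le> D1"
    and sol: "\<And>\<epsilon>. 0 < \<epsilon> \<Longrightarrow> switching_solution m r b D0 D1 T \<epsilon> w (q \<epsilon>) (\<sigma> \<epsilon>)"
begin

abbreviation "dn \<epsilon> \<equiv> down_time (q \<epsilon>) b T"
abbreviation "up \<epsilon> \<equiv> up_time (q \<epsilon>) b T"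

lemma path: "0 < \<epsilon> \<Longrightarrow> switching_path m r b D0 D1 T \<epsilon> w (q \<epsilon>) (\<sigma> \<epsilon>)"
  using r b T sol by unfold_locales auto

lemma burst_eq_mean_value:
  assumes "0 < \<epsilon>" "continuous_on UNIV \<phi>"
  shows "\<exists>\<xi>. \<xi> \<in> {up \<epsilon> k..dn \<epsilon> (Suc k)} \<and>
    r / \<epsilon> * (LBINT t:{up \<epsilon> k..<dn \<epsilon> (Suc k)}. \<phi> t) = r / \<epsilon> * (dn \<epsilon> (Suc k) - up \<epsilon> k) * \<phi> \<xi>"
proof -
  interpret p: switching_path m r b D0 D1 T \<epsilon> w "q \<epsilon>" "\<sigma> \<epsilon>" using assms(1) by (rule path)
  have "continuous_on {up \<epsilon> k..dn \<epsilon> (Suc k)} \<phi>"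
    by (rule continuous_on_subset[OF assms(2)]) simp
  from LBINT_mean_value[OF this p.up_le_dn]
  obtain \<xi> where "\<xi> \<in> {up \<epsilon> k..dn \<epsilon> (Suc k)}"
    "(LBINT t:{up \<epsilon> k..<dn \<epsilon> (Suc k)}. \<phi> t) = (dn \<epsilon> (Suc k) - up \<epsilon> k) * \<phi> \<xi>" .
  then show ?thesis by auto
qed

text \<open>The two pairings are bounded separately, without cancellation. There are at most 8^n
  \<le> 8 C^3 K^3 bursts, each of mass at most (b + 30 D1) K; the limit has total mass at most (m L
  + 15 D0) K, and K \<le> K^4. The horizon \<open>L\<close> exceeds 0 even if \<open>T = 0\<close>,
  so that the grid is not degenerate.\<close>

lemma pairing_error_le:
  assumes eps: "0 < \<epsilon>" and m: "0 \<le> m" and D0: "0 \<le> D0"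
    and \<phi>: "continuous_on UNIV \<phi>" "\<And>t. t \<le> 0 \<Longrightarrow> \<phi> t = 0" "\<And>t. \<bar>\<phi> t\<bar> \<le> \<Phi>"
    and L: "T \<le> L" "0 < L" and K: "1 \<le> K"
    and incr: "\<And>n j. j < 8^n \<Longrightarrow>
      \<bar>w (L * ((real j + 1) / 8^n)) - w (L * (real j / 8^n))\<bar> \<le> K / 2^n"
  shows "\<bar>(LBINT t:{0<..}. \<sigma> \<epsilon> t * \<phi> t) - b * (\<Sum>i\<in>{1..count_hits E b T}. \<phi> (\<tau> i))\<bar>
    \<le> \<Phi> * (8 * (1 + (15 * D0 + m * L) / b)^3 * (b + 30 * D1) + (m * L + 15 * D0)) * K^4"
proof -
  interpret p: switching_path m r b D0 D1 T \<epsilon> w "q \<epsilon>" "\<sigma> \<epsilon>" using eps by (rule path)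
  \<comment> \<open>Chosen so that (15 D0 + m L) / C < b, hence an oscillation of the energy by at
    most (15 D0 + m L) K / 2^n stays below \<open>b\<close> once C K \<le> 2^n.\<close>
  define C where "C = 1 + (15 * D0 + m * L) / b"
  have C: "1 \<le> C" using m D0 L b by (simp add: C_def)
  have \<Phi>: "0 \<le> \<Phi>" using \<phi>(3)[of 0] by simp
  have osc: "\<bar>w x - w y\<bar> \<le> 15 * K / 2^n"
    if "x \<in> {0..T}" "y \<in> {0..T}" "\<bar>x - y\<bar> \<le> L / 8^n" for x y n
  proof -
    have "continuous_on {0..1} (\<lambda>z. w (L * z))"
      using L by (intro continuous_on_compose2[OF w_cont]) (auto intro!: continuous_intros)
    moreover have "\<bar>x / L - y / L\<bar> \<le> 1 / 8^n"
      using divide_right_mono[OF that(3), of L] L by (simp flip: diff_divide_distrib)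
    ultimately have "\<bar>w (L * (x / L)) - w (L * (y / L))\<bar> \<le> 15 * K / 2^n"
      using that(1,2) L by (intro chaining_modulus[where f = "\<lambda>z. w (L * z)"] incr) (auto simp: field_simps)
    then show ?thesis using L by simp
  qed
  have wmax: "\<bar>w x\<bar> \<le> 15 * K" if "x \<in> {0..T}" for x
    using osc[of x 0 0] that T L w_0 by simp
  have Emax: "E x \<le> (m * L + 15 * D0) * K" if "x \<in> {0..T}" for x
  proof -
    have "D0 * w x \<le> D0 * (15 * K)"
      using wmax[OF that] D0 by (intro mult_left_mono) auto
    moreover have "m * x \<le> m * L" using that L m by (intro mult_left_mono) auto
    moreover have "m * L * 1 \<le> m * L * K" using K m L by (intro mult_left_mono) auto
    ultimately show ?thesis by (simp add: E_eq algebra_simps)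
  qed
  \<comment> \<open>The least admissible \<open>n\<close> overshoots by a factor of at most 2, which
    is the origin of 8 = 2^3 in the bound.\<close>
  obtain n where n: "C * K \<le> 2^n" "2^n \<le> 2 * C * K"
  proof -
    define n where "n = (LEAST n. C * K \<le> 2^n)"
    have ex: "\<exists>n. C * K \<le> 2^n"
      using real_arch_pow[of 2 "C * K"] by (auto intro: less_imp_le)
    have "C * K \<le> 2^n" unfolding n_def using ex by (rule LeastI_ex)
    moreover have "2^n \<le> 2 * C * K"
    proof (cases n)
      case 0
      have "1 * 1 \<le> C * K" using C K by (intro mult_mono) auto
      then show ?thesis using 0 by simp
    next
      case (Suc n')
      then have "\<not> C * K \<le> 2^n'" using not_less_Least[of n' "\<lambda>n. C * K \<le> 2^n"] n_def by simp
      then show ?thesis using Suc by simp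
    qed
    ultimately show ?thesis by (rule that)
  qed
  \<comment> \<open>The 8^n cells of length \<open>L / 8^n\<close> cover \<open>[0, T]\<close>;
    phases are numbered from 0, hence the index \<open>8^n - 1\<close>.\<close>
  have "p.up (8^n - 1) = T"
  proof (rule p.up_eq_T[where \<delta> = "L / 8^n"])
    have "real (Suc (8 ^ n - 1)) = 8 ^ n" by simp
    then show "T \<le> real (Suc (8 ^ n - 1)) * (L / 8 ^ n)" using L by simp
  next
    fix x y assume xy: "x \<in> {0..T}" "y \<in> {0..T}" "\<bar>x - y\<bar> \<le> L / 8^n"
    have "L / 8^n \<le> L / 2^n" using L by (intro divide_left_mono power_mono) auto
    also have "\<dots> \<le> L * K / 2^n" using L K by (intro divide_right_mono) auto
    finally have "m * \<bar>x - y\<bar> \<le> m * (L * K / 2^n)"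
      using xy(3) m by (intro mult_left_mono) auto
    moreover have "D0 * \<bar>w x - w y\<bar> \<le> D0 * (15 * K / 2^n)"
      using osc[OF xy] D0 by (intro mult_left_mono)
    moreover have "m * (L * K / 2^n) + D0 * (15 * K / 2^n) = (15 * D0 + m * L) * (K / 2^n)"
      by (simp add: algebra_simps)
    moreover have "\<bar>m * (x - y) + D0 * (w x - w y)\<bar> \<le> m * \<bar>x - y\<bar> + D0 * \<bar>w x - w y\<bar>"
      using m D0 by (intro order_trans[OF abs_triangle_ineq]) (simp add: abs_mult)
    ultimately have "\<bar>m * (x - y) + D0 * (w x - w y)\<bar> \<le> (15 * D0 + m * L) * (K / 2^n)"
      by linarith
    also have "K / 2^n \<le> 1 / C" using n(1) C by (simp add: field_simps)
    then have "(15 * D0 + m * L) * (K / 2^n) \<le> (15 * D0 + m * L) * (1 / C)"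
      using m D0 L by (intro mult_left_mono) auto
    also have "\<dots> < b"
      using C b by (simp add: C_def field_simps)
    finally show "\<bar>m * (x - y) + D0 * (w x - w y)\<bar> < b" .
  qed
  then have pair: "(LBINT t:{0<..}. \<sigma> \<epsilon> t * \<phi> t)
      = (\<Sum>k\<le>8^n - 1. r / \<epsilon> * (LBINT t:{p.up k..<p.dn (Suc k)}. \<phi> t))"
    by (intro p.pairing_eq \<phi>)
  have burst: "\<bar>r / \<epsilon> * (LBINT t:{p.up k..<p.dn (Suc k)}. \<phi> t)\<bar> \<le> (b + 30 * D1) * K * \<Phi>" for k
  proof -
    define \<mu> where "\<mu> = r / \<epsilon> * (p.dn (Suc k) - p.up k)"
    obtain \<xi> where "r / \<epsilon> * (LBINT t:{p.up k..<p.dn (Suc k)}. \<phi> t) = \<mu> * \<phi> \<xi>"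
      unfolding \<mu>_def using burst_eq_mean_value[OF eps \<phi>(1), of k] by blast
    moreover have "0 \<le> \<mu>"
      using r eps p.up_le_dn[of k] by (simp add: \<mu>_def)
    moreover have "\<mu> \<le> (b + 30 * D1) * K"
    proof -
      have "\<mu> \<le> b + 2 * D1 * (15 * K)"
        unfolding \<mu>_def using D1 wmax by (rule p.burst_mass_le)
      moreover have "b * 1 \<le> b * K" using b K by (intro mult_left_mono) auto
      ultimately show ?thesis by (simp add: algebra_simps)
    qed
    ultimately show ?thesis
      using \<phi>(3)[of \<xi>] by (auto simp: abs_mult intro!: mult_mono)
  qed
  have "\<bar>LBINT t:{0<..}. \<sigma> \<epsilon> t * \<phi> t\<bar> \<le> (\<Sum>k\<le>(8::nat)^n - 1. (b + 30 * D1) * K * \<Phi>)"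
    unfolding pair by (rule order_trans[OF sum_abs sum_mono]) (rule burst)
  also have "\<dots> = 8^n * ((b + 30 * D1) * K * \<Phi>)" by simp
  also have "\<dots> \<le> (2 * C * K)^3 * ((b + 30 * D1) * K * \<Phi>)"
  proof (rule mult_right_mono)
    have "(8::real)^n = (2^3)^n" by simp
    also have "\<dots> = (2^n)^3" by (simp only: power_mult[symmetric] mult.commute)
    also have "\<dots> \<le> (2 * C * K)^3" using n(2) by (rule power_mono) simp
    finally show "8^n \<le> (2 * C * K)^3" .
    show "0 \<le> (b + 30 * D1) * K * \<Phi>" using b D1 K \<Phi> by simp
  qed
  also have "\<dots> = \<Phi> * (8 * C^3 * (b + 30 * D1)) * K^4"
    by (simp add: power_mult_distrib eval_nat_numeral)
  finally have 1: "\<bar>LBINT t:{0<..}. \<sigma> \<epsilon> t * \<phi> t\<bar> \<le> \<Phi> * (8 * C^3 * (b + 30 * D1)) * K^4" .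
  have "\<bar>\<Sum>i\<in>{1..count_hits E b T}. \<phi> (\<tau> i)\<bar> \<le> (\<Sum>i\<in>{1..count_hits E b T}. \<Phi>)"
    by (rule order_trans[OF sum_abs sum_mono]) (rule \<phi>(3))
  then have "\<bar>b * (\<Sum>i\<in>{1..count_hits E b T}. \<phi> (\<tau> i))\<bar> \<le> b * (real (count_hits E b T) * \<Phi>)"
    using b by (simp add: abs_mult)
  also have "\<dots> = real (count_hits E b T) * b * \<Phi>" by simp
  also have "\<dots> \<le> (m * L + 15 * D0) * K * \<Phi>"
    using Emax \<Phi> by (intro mult_right_mono count_hits_set(2))
  also have "\<dots> \<le> (m * L + 15 * D0) * K^4 * \<Phi>"
    using power_increasing[of 1 4 K] K m L D0 \<Phi> by (intro mult_right_mono mult_left_mono) auto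
  finally have 2: "\<bar>b * (\<Sum>i\<in>{1..count_hits E b T}. \<phi> (\<tau> i))\<bar> \<le> \<Phi> * (m * L + 15 * D0) * K^4"
    by (simp add: algebra_simps)
  show ?thesis
    using 1 2 unfolding C_def[symmetric] by (simp add: algebra_simps abs_le_iff)
qed

end

text \<open>The two null events are excluded here: \<open>crossing\<close> forbids merely touching a
  level, and \<open>E_T\<close> forbids a hit at time \<open>T\<close> exactly, where the number of
  hits jumps.\<close>

locale generic_path_family = energy_path_family +
  assumes crossing: "\<And>k x. 1 \<le> k \<Longrightarrow> \<tau> k < x \<Longrightarrow> \<exists>u\<in>{\<tau> k<..<x}. real k * b < E u"
    and E_T: "\<And>k. 1 \<le> k \<Longrightarrow> E T \<noteq> real k * b"
begin

lemma eventually_path: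
  "eventually (\<lambda>\<epsilon>. switching_path m r b D0 D1 T \<epsilon> w (q \<epsilon>) (\<sigma> \<epsilon>)) (at_right 0)"
  using eventually_at_right_less[of 0] by eventually_elim (rule path)

lemma tau_neq_T: "1 \<le> k \<Longrightarrow> \<tau> k \<noteq> T"
  using E_tau[of k] E_T[of k] by auto

text \<open>The mass bound depends on the path alone, not on \<epsilon>, and the length is the mass
  times \<epsilon> / r.\<close>

lemma burst_length_tendsto: "((\<lambda>\<epsilon>. dn \<epsilon> (Suc k) - up \<epsilon> k) \<longlongrightarrow> 0) (at_right 0)"
proof -
  have "continuous_on {0..T} (\<lambda>x. \<bar>w x\<bar>)"
    by (intro continuous_intros continuous_on_subset[OF w_cont]) auto
  then obtain y where y: "\<And>x. x \<in> {0..T} \<Longrightarrow> \<bar>w x\<bar> \<le> \<bar>w y\<bar>"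
    using continuous_attains_sup[of "{0..T}" "\<lambda>x. \<bar>w x\<bar>"] T by force
  let ?B = "b + 2 * D1 * \<bar>w y\<bar>"
  show ?thesis
  proof (rule tendsto_sandwich)
    show "eventually (\<lambda>\<epsilon>. 0 \<le> dn \<epsilon> (Suc k) - up \<epsilon> k) (at_right 0)"
      using eventually_path by eventually_elim (simp add: switching_path.up_le_dn)
    show "eventually (\<lambda>\<epsilon>. dn \<epsilon> (Suc k) - up \<epsilon> k \<le> \<epsilon> * (?B / r)) (at_right 0)"
      using eventually_path eventually_at_right_less[of 0]
    proof eventually_elim
      case (elim \<epsilon>)
      have "r / \<epsilon> * (dn \<epsilon> (Suc k) - up \<epsilon> k) \<le> ?B"
        using elim(1) D1 y by (rule switching_path.burst_mass_le)
      then show ?case using elim(2) r by (simp add: field_simps)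
    qed
    have "((\<lambda>\<epsilon>. \<epsilon> * (?B / r)) \<longlongrightarrow> 0 * (?B / r)) (at_right 0)"
      by (intro tendsto_intros)
    then show "((\<lambda>\<epsilon>. \<epsilon> * (?B / r)) \<longlongrightarrow> 0) (at_right 0)" by simp
  qed auto
qed

text \<open>Knowing that the \<open>k\<close>-th return to zero is close to a time at which the energy is \<open>k b\<close>,
  the next threshold crossing is squeezed against \<open>\<tau> (Suc k)\<close>: from below because the energy stays
  away from level \<open>(k + 1) b\<close> before \<open>\<tau> (Suc k)\<close>, from above because it exceeds that level right
  after.\<close>

lemma
  assumes lim: "((\<lambda>\<epsilon>. dn \<epsilon> k) \<longlongrightarrow> p) (at_right 0)"
    and p: "0 \<le> p" "p < T" "E p = real k * b" "p < \<tau> (Suc k)"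
  shows up_eq_T_eventually: "T < \<tau> (Suc k) \<Longrightarrow> eventually (\<lambda>\<epsilon>. up \<epsilon> k = T) (at_right 0)"
    and up_tendsto: "\<tau> (Suc k) < T \<Longrightarrow> ((\<lambda>\<epsilon>. up \<epsilon> k) \<longlongrightarrow> \<tau> (Suc k)) (at_right 0)"
proof -
  have "eventually (\<lambda>\<epsilon>. dn \<epsilon> k \<in> {0..}) (at_right 0)"
    using eventually_path by eventually_elim (simp add: switching_path.dn_bounds)
  then have Elim: "((\<lambda>\<epsilon>. E (dn \<epsilon> k)) \<longlongrightarrow> real k * b) (at_right 0)"
    using continuous_on_tendsto_compose[OF E_cont lim] p by simp
  have dnT: "eventually (\<lambda>\<epsilon>. dn \<epsilon> k < T) (at_right 0)"
    using lim p(2) by (rule order_tendstoD)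
  \<comment> \<open>The alternative \<open>up \<epsilon> k = T\<close> must be kept: a truncated
    time need not be a hit of \<open>b\<close>, so nothing is known about \<open>q\<close>
    there.\<close>
  have lower: "eventually (\<lambda>\<epsilon>. x < up \<epsilon> k \<or> up \<epsilon> k = T) (at_right 0)"
    if x: "x < \<tau> (Suc k)" for x
  proof (cases "x < 0")
    case True
    show ?thesis
      using eventually_path
    proof eventually_elim
      case (elim \<epsilon>)
      then show ?case using True switching_path.up_nonneg[OF elim, of k] by simp
    qed
  next
    case False
    \<comment> \<open>By compactness the maximum of \<open>E\<close> over \<open>[0, x]\<close> is
      attained, which leaves a positive gap below level (k + 1) b to absorb the error in
      \<open>E (dn \<epsilon> k)\<close>.\<close>
    obtain y where y: "y \<in> {0..x}" "\<And>z. z \<in> {0..x} \<Longrightarrow> E z \<le> E y"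
      using continuous_attains_sup[of "{0..x}" E] False continuous_on_subset[OF E_cont, of "{0..x}"]
      by auto
    have "E y < real (Suc k) * b" using y(1) x by (intro E_before_tau) auto
    then have "E y - b < real k * b" by (simp add: algebra_simps)
    with Elim have "eventually (\<lambda>\<epsilon>. E y - b < E (dn \<epsilon> k)) (at_right 0)"
      by (rule order_tendstoD)
    with dnT eventually_path show ?thesis
    proof eventually_elim
      case (elim \<epsilon>)
      interpret p: switching_path m r b D0 D1 T \<epsilon> w "q \<epsilon>" "\<sigma> \<epsilon>" by fact
      show ?case
      proof (rule ccontr)
        assume "\<not> ?case"
        then have u: "p.up k \<le> x" "p.up k < T" using p.up_le[of k] by auto
        have "E (p.up k) - E (p.dn k) = b"
          using p.q_off[of k "p.up k"] p.dn_le_up[of k] p.q_up[OF u(2)] p.q_dn[OF elim(1)]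
          by (simp add: E_eq algebra_simps)
        moreover have "E (p.up k) \<le> E y" using y(2) u(1) p.up_nonneg[of k] by auto
        ultimately show False using elim(3) by simp
      qed
    qed
  qed
  show "eventually (\<lambda>\<epsilon>. up \<epsilon> k = T) (at_right 0)" if "T < \<tau> (Suc k)"
    using lower[OF that] eventually_path
  proof eventually_elim
    case (elim \<epsilon>)
    then show ?case using switching_path.up_le[OF elim(2), of k] by simp
  qed
  show "((\<lambda>\<epsilon>. up \<epsilon> k) \<longlongrightarrow> \<tau> (Suc k)) (at_right 0)" if T: "\<tau> (Suc k) < T"
  proof (rule order_tendstoI)
    fix x assume x: "x < \<tau> (Suc k)"
    show "eventually (\<lambda>\<epsilon>. x < up \<epsilon> k) (at_right 0)"
      using lower[OF x] by eventually_elim (use x T in auto)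
  next
    fix x assume "\<tau> (Suc k) < x"
    then have "\<tau> (Suc k) < min x T" using T by simp
    \<comment> \<open>The strict excess of \<open>E u\<close> over (k + 1) b outweighs the error in
      \<open>E (dn \<epsilon> k)\<close>: if the phase lasted beyond \<open>u\<close>, then
      \<open>q\<close> would have reached \<open>b\<close> by time \<open>u\<close>.\<close>
    then obtain u where u: "\<tau> (Suc k) < u" "u < min x T" "real (Suc k) * b < E u"
      using crossing[of "Suc k" "min x T"] by auto
    have "eventually (\<lambda>\<epsilon>. E (dn \<epsilon> k) < E u - b) (at_right 0)"
      using Elim by (rule order_tendstoD) (use u(3) in \<open>simp add: algebra_simps\<close>)
    moreover have "eventually (\<lambda>\<epsilon>. dn \<epsilon> k < u) (at_right 0)"
      using lim by (rule order_tendstoD) (use u p in simp)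
    ultimately show "eventually (\<lambda>\<epsilon>. up \<epsilon> k < x) (at_right 0)"
      using dnT eventually_path
    proof eventually_elim
      case (elim \<epsilon>)
      interpret p: switching_path m r b D0 D1 T \<epsilon> w "q \<epsilon>" "\<sigma> \<epsilon>" by fact
      show ?case
      proof (rule ccontr)
        assume "\<not> ?case"
        then have ux: "u < p.up k" using u by simp
        have "q \<epsilon> u = E u - E (p.dn k)"
          using p.q_off[of k u] elim(2) ux p.q_dn[OF elim(3)] by (simp add: E_eq algebra_simps)
        then have "b \<le> q \<epsilon> u" using elim(1) by simp
        moreover have "continuous_on {p.dn k..u} (q \<epsilon>)"
          using u by (intro continuous_on_subset[OF p.dn_cont]) auto
        ultimately obtain v where "p.dn k \<le> v" "v \<le> u" "q \<epsilon> v = b"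
          using IVT'[of "q \<epsilon>" "p.dn k" b u] p.q_dn[OF elim(3)] b elim(2) by auto
        then show False using p.q_before_up[of k v] ux by simp
      qed
    qed
  qed
qed

lemma dn_tendsto:
  assumes "((\<lambda>\<epsilon>. up \<epsilon> k) \<longlongrightarrow> p) (at_right 0)"
  shows "((\<lambda>\<epsilon>. dn \<epsilon> (Suc k)) \<longlongrightarrow> p) (at_right 0)"
  using tendsto_add[OF burst_length_tendsto[of k] assms] by simp

text \<open>Induction over the phases: \<open>up\<close> tends to \<tau>, the vanishing burst length
  carries this over to the next \<open>dn\<close>, and that feeds the next phase. Once a time is
  stuck at \<open>T\<close>, so are all later ones. \<open>T = 0\<close> is separate because the
  step wants a start strictly before \<open>T\<close>.\<close>

lemma switching_times_tendsto:
  "(\<tau> (Suc k) < T \<longrightarrow> ((\<lambda>\<epsilon>. up \<epsilon> k) \<longlongrightarrow> \<tau> (Suc k)) (at_right 0)) \<and>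
   (T < \<tau> (Suc k) \<longrightarrow> eventually (\<lambda>\<epsilon>. up \<epsilon> k = T) (at_right 0))"
proof (induction k)
  case 0
  show ?case
  proof (cases "T = 0")
    case True
    have "eventually (\<lambda>\<epsilon>. up \<epsilon> 0 = T) (at_right 0)"
      using eventually_path
    proof eventually_elim
      case (elim \<epsilon>)
      then show ?case
        using switching_path.up_le[OF elim, of 0] switching_path.up_nonneg[OF elim, of 0] True by simp
    qed
    then show ?thesis using tau_pos[of "Suc 0"] True by simp
  next
    case False
    have "((\<lambda>\<epsilon>. dn \<epsilon> 0) \<longlongrightarrow> 0) (at_right 0)" by simp
    note * = up_tendsto[OF this] up_eq_T_eventually[OF this]
    show ?thesis using * tau_pos[of "Suc 0"] False T E_0 by simp
  qed
next
  case (Suc k)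
  have mono: "\<tau> (Suc k) < \<tau> (Suc (Suc k))" by (rule tau_mono) auto
  show ?case
  proof (cases "\<tau> (Suc k) < T")
    case True
    then have "((\<lambda>\<epsilon>. dn \<epsilon> (Suc k)) \<longlongrightarrow> \<tau> (Suc k)) (at_right 0)"
      using Suc dn_tendsto by blast
    note * = up_tendsto[OF this] up_eq_T_eventually[OF this]
    show ?thesis
      using * tau_pos[of "Suc k"] True E_tau[of "Suc k"] mono by (simp add: less_imp_le)
  next
    case False
    then have gt: "T < \<tau> (Suc k)" using tau_neq_T[of "Suc k"] by simp
    then have "eventually (\<lambda>\<epsilon>. up \<epsilon> k = T) (at_right 0)" using Suc by blast
    then have "eventually (\<lambda>\<epsilon>. up \<epsilon> (Suc k) = T) (at_right 0)"
      using eventually_path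
    proof eventually_elim
      case (elim \<epsilon>)
      interpret p: switching_path m r b D0 D1 T \<epsilon> w "q \<epsilon>" "\<sigma> \<epsilon>" by fact
      show ?case
        using elim(1) p.up_le_dn[of k] p.dn_le_up[of "Suc k"] p.up_le[of "Suc k"] by linarith
    qed
    then show ?thesis using gt mono by simp
  qed
qed

text \<open>The mass tends to \<open>b\<close> because both ends of the burst tend to the same time
  and \<open>w\<close> is continuous there; the mean value point is squeezed between these
  ends.\<close>

lemma burst_tendsto:
  assumes \<phi>: "continuous_on UNIV \<phi>"
  shows "((\<lambda>\<epsilon>. r / \<epsilon> * (LBINT t:{up \<epsilon> k..<dn \<epsilon> (Suc k)}. \<phi> t)) \<longlongrightarrow>
    (if \<tau> (Suc k) \<le> T then b * \<phi> (\<tau> (Suc k)) else 0)) (at_right 0)"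
proof (cases "\<tau> (Suc k) < T")
  case True
  then have up: "((\<lambda>\<epsilon>. up \<epsilon> k) \<longlongrightarrow> \<tau> (Suc k)) (at_right 0)"
    using switching_times_tendsto by blast
  note dn = dn_tendsto[OF up]
  have w: "((\<lambda>\<epsilon>. w (f \<epsilon>)) \<longlongrightarrow> w (\<tau> (Suc k))) (at_right 0)"
    if "(f \<longlongrightarrow> \<tau> (Suc k)) (at_right 0)" for f
  proof -
    have "eventually (\<lambda>\<epsilon>. 0 < f \<epsilon>) (at_right 0)"
      using that by (rule order_tendstoD) (simp add: tau_pos)
    then have "eventually (\<lambda>\<epsilon>. f \<epsilon> \<in> {0..}) (at_right 0)" by eventually_elim simp
    then show ?thesis
      using continuous_on_tendsto_compose[OF w_cont that] tau_pos[of "Suc k"] by simp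
  qed
  have "((\<lambda>\<epsilon>. b + D1 * (w (dn \<epsilon> (Suc k)) - w (up \<epsilon> k))) \<longlongrightarrow> b + D1 * (w (\<tau> (Suc k)) - w (\<tau> (Suc k))))
      (at_right 0)"
    by (intro tendsto_intros w up dn)
  \<comment> \<open>Eventually \<open>dn \<epsilon> (Suc k) < T\<close>, so the burst is complete
    and its mass is given by an equation.\<close>
  moreover have "eventually (\<lambda>\<epsilon>. b + D1 * (w (dn \<epsilon> (Suc k)) - w (up \<epsilon> k))
      = r / \<epsilon> * (dn \<epsilon> (Suc k) - up \<epsilon> k)) (at_right 0)"
    using order_tendstoD(2)[OF dn True] eventually_path
    by eventually_elim (rule switching_path.burst_mass_eq[symmetric])
  ultimately have mass: "((\<lambda>\<epsilon>. r / \<epsilon> * (dn \<epsilon> (Suc k) - up \<epsilon> k)) \<longlongrightarrow> b) (at_right 0)"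
    by (simp add: tendsto_cong)
  have "\<forall>\<epsilon>\<in>{0<..}. \<exists>\<xi>. \<xi> \<in> {up \<epsilon> k..dn \<epsilon> (Suc k)} \<and>
      r / \<epsilon> * (LBINT t:{up \<epsilon> k..<dn \<epsilon> (Suc k)}. \<phi> t)
        = r / \<epsilon> * (dn \<epsilon> (Suc k) - up \<epsilon> k) * \<phi> \<xi>"
    using burst_eq_mean_value[OF _ \<phi>] by blast
  from bchoice[OF this] obtain \<xi> where
    \<xi>: "\<forall>\<epsilon>\<in>{0<..}. \<xi> \<epsilon> \<in> {up \<epsilon> k..dn \<epsilon> (Suc k)} \<and>
      r / \<epsilon> * (LBINT t:{up \<epsilon> k..<dn \<epsilon> (Suc k)}. \<phi> t)
        = r / \<epsilon> * (dn \<epsilon> (Suc k) - up \<epsilon> k) * \<phi> (\<xi> \<epsilon>)" ..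
  have "(\<xi> \<longlongrightarrow> \<tau> (Suc k)) (at_right 0)"
    by (rule tendsto_sandwich[OF _ _ up dn])
      (use \<xi> in \<open>auto intro!: eventually_mono[OF eventually_at_right_less]\<close>)
  then have "((\<lambda>\<epsilon>. \<phi> (\<xi> \<epsilon>)) \<longlongrightarrow> \<phi> (\<tau> (Suc k))) (at_right 0)"
    by (rule continuous_on_tendsto_compose[OF \<phi>]) auto
  from tendsto_mult[OF mass this]
  have "((\<lambda>\<epsilon>. r / \<epsilon> * (LBINT t:{up \<epsilon> k..<dn \<epsilon> (Suc k)}. \<phi> t)) \<longlongrightarrow> b * \<phi> (\<tau> (Suc k))) (at_right 0)"
  proof (rule Lim_transform_eventually)
    show "eventually (\<lambda>\<epsilon>. r / \<epsilon> * (dn \<epsilon> (Suc k) - up \<epsilon> k) * \<phi> (\<xi> \<epsilon>)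
        = r / \<epsilon> * (LBINT t:{up \<epsilon> k..<dn \<epsilon> (Suc k)}. \<phi> t)) (at_right 0)"
      using eventually_at_right_less[of 0]
    proof eventually_elim
      case (elim \<epsilon>)
      then show ?case using bspec[OF \<xi>, of \<epsilon>] by (simp only: greaterThan_iff)
    qed
  qed
  then show ?thesis using True by simp
next
  case False
  then have gt: "T < \<tau> (Suc k)" using tau_neq_T[of "Suc k"] by simp
  then have "eventually (\<lambda>\<epsilon>. up \<epsilon> k = T) (at_right 0)"
    using switching_times_tendsto by blast
  then have "eventually (\<lambda>\<epsilon>. 0 = r / \<epsilon> * (LBINT t:{up \<epsilon> k..<dn \<epsilon> (Suc k)}. \<phi> t)) (at_right 0)"
    using eventually_path
  proof eventually_elim
    case (elim \<epsilon>)
    have "{up \<epsilon> k..<dn \<epsilon> (Suc k)} = {}"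
      using elim(1) switching_path.dn_bounds[OF elim(2), of "Suc k"] by simp
    then show ?case by (simp add: set_lebesgue_integral_def)
  qed
  then show ?thesis using gt by (auto intro: Lim_transform_eventually[OF tendsto_const])
qed

text \<open>Uniform continuity of \<open>E\<close> on \<open>[0, T]\<close> bounds the number of
  bursts independently of \<epsilon>, so the limit can be taken in a fixed finite sum.\<close>

lemma pairing_tendsto:
  assumes \<phi>: "continuous_on UNIV \<phi>" "\<And>t. t \<le> 0 \<Longrightarrow> \<phi> t = 0"
  shows "((\<lambda>\<epsilon>. LBINT t:{0<..}. \<sigma> \<epsilon> t * \<phi> t) \<longlongrightarrow>
    b * (\<Sum>i\<in>{1..count_hits E b T}. \<phi> (\<tau> i))) (at_right 0)"
proof -
  have cont: "continuous_on {0..T} E" by (rule continuous_on_subset[OF E_cont]) auto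
  then have "uniformly_continuous_on {0..T} E" by (intro compact_uniformly_continuous) auto
  then obtain d where d: "0 < d" "\<And>x y. x \<in> {0..T} \<Longrightarrow> y \<in> {0..T} \<Longrightarrow> dist x y < d \<Longrightarrow> dist (E x) (E y) < b"
    unfolding uniformly_continuous_on_def using b by metis
  obtain y where y: "\<And>x. x \<in> {0..T} \<Longrightarrow> E x \<le> E y"
    using continuous_attains_sup[of "{0..T}" E] cont T by force
  \<comment> \<open>Half of \<open>d\<close>, since uniform continuity speaks of distances
    \<open>< d\<close> and \<open>up_eq_T\<close> of distances
    \<open>\<le> \<delta>\<close>.\<close>
  obtain n where "T < real n * (d / 2)" using reals_Archimedean3[of "d / 2"] d(1) by auto
  then have n: "T \<le> real (Suc n) * (d / 2)" using d(1) by (simp add: field_simps)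
  have up_T: "up \<epsilon> n = T" if "0 < \<epsilon>" for \<epsilon>
  proof (rule switching_path.up_eq_T[OF path[OF that] _ n])
    fix x y assume "x \<in> {0..T}" "y \<in> {0..T}" "\<bar>x - y\<bar> \<le> d / 2"
    then have "dist (E x) (E y) < b" using d(1) by (intro d(2)) (auto simp: dist_real_def)
    then show "\<bar>m * (x - y) + D0 * (w x - w y)\<bar> < b"
      by (simp add: dist_real_def E_eq algebra_simps)
  qed
  \<comment> \<open>The same \<open>n\<close> bounds the hits of \<open>E\<close>: an earlier
    \<open>\<tau> (Suc n)\<close> would be the limit of \<open>up \<epsilon> n\<close>, which is
    constantly \<open>T\<close>.\<close>
  have "T < \<tau> (Suc n)"
  proof (rule ccontr)
    assume "\<not> ?thesis"
    then have lt: "\<tau> (Suc n) < T" using tau_neq_T[of "Suc n"] by simp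
    then have "((\<lambda>\<epsilon>. up \<epsilon> n) \<longlongrightarrow> \<tau> (Suc n)) (at_right 0)" using switching_times_tendsto by blast
    moreover have "((\<lambda>\<epsilon>. up \<epsilon> n) \<longlongrightarrow> T) (at_right 0)"
      by (rule Lim_transform_eventually[OF tendsto_const])
        (auto intro!: eventually_mono[OF eventually_at_right_less] simp: up_T)
    ultimately show False using tendsto_unique[of "at_right (0::real)"] lt by force
  qed
  moreover have hits: "{1..count_hits E b T} = {k. 1 \<le> k \<and> \<tau> k \<le> T}"
    using y by (intro count_hits_set(1)[symmetric])
  ultimately have le: "{1..count_hits E b T} \<subseteq> {1..Suc n}"
    using tau_mono[of "Suc n"] by (force simp: not_le)
  have "((\<lambda>\<epsilon>. \<Sum>k\<le>n. r / \<epsilon> * (LBINT t:{up \<epsilon> k..<dn \<epsilon> (Suc k)}. \<phi> t)) \<longlongrightarrow>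
      (\<Sum>k\<le>n. if \<tau> (Suc k) \<le> T then b * \<phi> (\<tau> (Suc k)) else 0)) (at_right 0)"
    by (intro tendsto_sum burst_tendsto \<phi>)
  moreover have "(\<Sum>k\<le>n. if \<tau> (Suc k) \<le> T then b * \<phi> (\<tau> (Suc k)) else 0)
      = (\<Sum>i\<in>{1..Suc n}. if \<tau> i \<le> T then b * \<phi> (\<tau> i) else 0)"
    by (rule sum.reindex_bij_witness[where i = "\<lambda>i. i - 1" and j = Suc]) auto
  also have "\<dots> = (\<Sum>i\<in>{1..Suc n} \<inter> {i. \<tau> i \<le> T}. b * \<phi> (\<tau> i))"
    by (simp add: sum.inter_restrict)
  also have "{1..Suc n} \<inter> {i. \<tau> i \<le> T} = {1..Suc n} \<inter> {1..count_hits E b T}"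
    unfolding hits by auto
  also have "\<dots> = {1..count_hits E b T}" using le by auto
  finally have lim: "((\<lambda>\<epsilon>. \<Sum>k\<le>n. r / \<epsilon> * (LBINT t:{up \<epsilon> k..<dn \<epsilon> (Suc k)}. \<phi> t)) \<longlongrightarrow>
      b * (\<Sum>i\<in>{1..count_hits E b T}. \<phi> (\<tau> i))) (at_right 0)"
    by (simp add: sum_distrib_left)
  show ?thesis
  proof (rule Lim_transform_eventually[OF lim])
    show "eventually (\<lambda>\<epsilon>. (\<Sum>k\<le>n. r / \<epsilon> * (LBINT t:{up \<epsilon> k..<dn \<epsilon> (Suc k)}. \<phi> t))
        = (LBINT t:{0<..}. \<sigma> \<epsilon> t * \<phi> t)) (at_right 0)"
      using eventually_path eventually_at_right_less[of 0]
      by eventually_elim (intro switching_path.pairing_eq[symmetric] \<phi> up_T)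
  qed
qed

end

section \<open>Almost sure properties of Brownian motion\<close>

text \<open>No measurability of the \<open>f n\<close> is assumed: the nonnegative integral is a lower integral, so
  it suffices to apply dominated convergence to almost optimal simple minorants.\<close>

lemma nn_integral_dominated_tendsto_0:
  fixes f :: "nat \<Rightarrow> 'a \<Rightarrow> ennreal"
  assumes G[measurable]: "G \<in> borel_measurable M" and fin: "(\<integral>\<^sup>+x. G x \<partial>M) < \<infinity>"
    and le: "\<And>n. AE x in M. f n x \<le> G x"
    and lim: "AE x in M. (\<lambda>n. f n x) \<longlonglongrightarrow> 0"
  shows "(\<lambda>n. \<integral>\<^sup>+x. f n x \<partial>M) \<longlonglongrightarrow> 0"
proof -
  have "\<exists>g. simple_function M g \<and> g \<le> f n \<and>
      (\<integral>\<^sup>+x. f n x \<partial>M) \<le> (\<integral>\<^sup>+x. g x \<partial>M) + ennreal (1 / real (Suc n))" for n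
  proof -
    let ?A = "{g. simple_function M g \<and> g \<le> f n}"
    \<comment> \<open>The majorant makes the supremum finite; only then is there a minorant within
      \<open>1 / Suc n\<close> of it.\<close>
    have "(\<integral>\<^sup>+x. f n x \<partial>M) \<noteq> \<infinity>"
      using nn_integral_mono_AE[OF le[of n]] fin by (auto simp: top_unique)
    moreover have "(\<lambda>_. 0) \<in> ?A" by (simp add: le_fun_def)
    then have "?A \<noteq> {}" by blast
    ultimately obtain g where g: "g \<in> ?A"
      "(SUP g\<in>?A. integral\<^sup>S M g) < integral\<^sup>S M g + ennreal (1 / real (Suc n))"
      using SUP_approx_ennreal[of "1 / real (Suc n)" ?A "integral\<^sup>N M (f n)" "integral\<^sup>S M"]
      by (auto simp: nn_integral_def)
    then show ?thesis
      by (intro exI[of _ g]) (auto simp: nn_integral_eq_simple_integral nn_integral_def[of M "f n"])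
  qed
  then obtain g where g: "\<And>n. simple_function M (g n)" "\<And>n. g n \<le> f n"
      "\<And>n. (\<integral>\<^sup>+x. f n x \<partial>M) \<le> (\<integral>\<^sup>+x. g n x \<partial>M) + ennreal (1 / real (Suc n))"
    by metis
  have "(\<lambda>n. \<integral>\<^sup>+x. g n x \<partial>M) \<longlonglongrightarrow> (\<integral>\<^sup>+x. 0 \<partial>M)"
  proof (rule nn_integral_dominated_convergence[where w = G])
    show "AE x in M. g n x \<le> G x" for n
      using le[of n] by eventually_elim (use g(2)[of n] in \<open>auto simp: le_fun_def intro: order_trans\<close>)
    show "AE x in M. (\<lambda>n. g n x) \<longlonglongrightarrow> 0"
      using lim
    proof eventually_elim
      case (elim x)
      show ?case
        by (rule tendsto_sandwich[OF _ _ tendsto_const elim]) (use g(2) in \<open>auto simp: le_fun_def\<close>)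
    qed
  qed (use g(1) fin in \<open>auto intro: borel_measurable_simple_function\<close>)
  then have up: "(\<lambda>n. (\<integral>\<^sup>+x. g n x \<partial>M) + ennreal (1 / real (Suc n))) \<longlonglongrightarrow> 0 + ennreal 0"
    by (intro tendsto_add tendsto_ennrealI LIMSEQ_Suc[OF lim_1_over_n]) simp
  show ?thesis
    by (rule tendsto_sandwich[OF _ _ tendsto_const up[simplified]])
      (simp, intro always_eventually allI g(3)[simplified])
qed

text \<open>Fix the value of \<open>Y\<close> by Fubini: \<open>X\<close> is then confined to an
  interval of length 2 \<eta> / c, where its density is at most \<kappa>. The law of
  \<open>Y\<close> is arbitrary.\<close>

lemma (in prob_space) indep_small_ball:
  fixes X Y :: "'a \<Rightarrow> real"
  assumes ind: "indep_var borel X borel Y"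
    and dist: "distributed M lborel X (\<lambda>x. ennreal (f x))"
    and f: "\<And>x. f x \<le> \<kappa>" and c: "0 < c" and \<eta>: "0 \<le> \<eta>"
  shows "emeasure M {\<omega> \<in> space M. \<bar>c * X \<omega> + Y \<omega>\<bar> \<le> \<eta>} \<le> ennreal (2 * \<kappa> * \<eta> / c)"
proof -
  have X[measurable]: "X \<in> borel_measurable M" and Y[measurable]: "Y \<in> borel_measurable M"
    using indep_var_rv1[OF ind] indep_var_rv2[OF ind] by auto
  interpret X: prob_space "distr M borel X" by (rule prob_space_distr) simp
  interpret Y: prob_space "distr M borel Y" by (rule prob_space_distr) simp
  interpret pair_sigma_finite "distr M borel X" "distr M borel Y" ..
  define S where "S = {p \<in> space (borel \<Otimes>\<^sub>M borel). \<bar>c * fst p + snd p\<bar> \<le> \<eta>}"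
  have S[measurable]: "S \<in> sets (borel \<Otimes>\<^sub>M borel)"
    unfolding S_def by measurable
  have "{\<omega> \<in> space M. \<bar>c * X \<omega> + Y \<omega>\<bar> \<le> \<eta>} = (\<lambda>\<omega>. (X \<omega>, Y \<omega>)) -` S \<inter> space M"
    by (auto simp: S_def space_pair_measure)
  then have "emeasure M {\<omega> \<in> space M. \<bar>c * X \<omega> + Y \<omega>\<bar> \<le> \<eta>}
      = emeasure (distr M (borel \<Otimes>\<^sub>M borel) (\<lambda>\<omega>. (X \<omega>, Y \<omega>))) S"
    by (simp add: emeasure_distr)
  also have "\<dots> = emeasure (distr M borel X \<Otimes>\<^sub>M distr M borel Y) S"
    using ind by (simp add: indep_var_distribution_eq)
  also have "\<dots> = (\<integral>\<^sup>+y. emeasure (distr M borel X) ((\<lambda>x. (x, y)) -` S) \<partial>distr M borel Y)"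
    by (rule emeasure_pair_measure_alt2) (simp add: S cong: sets_pair_measure_cong)
  also have "\<dots> \<le> (\<integral>\<^sup>+y. ennreal (2 * \<kappa> * \<eta> / c) \<partial>distr M borel Y)"
  proof (rule nn_integral_mono)
    fix y
    let ?I = "{(- \<eta> - y) / c .. (\<eta> - y) / c}"
    have I: "(\<lambda>x. (x, y)) -` S = ?I"
      using c by (auto simp: S_def space_pair_measure field_simps abs_le_iff)
    have len: "(- \<eta> - y) / c \<le> (\<eta> - y) / c" using c \<eta> by (simp add: divide_right_mono)
    \<comment> \<open>A negative bound on the density would give \<open>X\<close> a law of total
      mass 0.\<close>
    have "0 \<le> \<kappa>"
    proof (rule ccontr)
      assume "\<not> 0 \<le> \<kappa>"
      then have "ennreal (f x) = 0" for x using f[of x] by (simp add: ennreal_neg)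
      then have "emeasure M (X -` UNIV \<inter> space M) = 0"
        using distributed_emeasure[OF dist, of UNIV] by simp
      then show False by (simp add: emeasure_space_1)
    qed
    have "emeasure (distr M borel X) ((\<lambda>x. (x, y)) -` S) = emeasure M (X -` ?I \<inter> space M)"
      unfolding I by (simp add: emeasure_distr)
    also have "\<dots> = (\<integral>\<^sup>+x. ennreal (f x) * indicator ?I x \<partial>lborel)"
      by (rule distributed_emeasure[OF dist]) simp
    also have "\<dots> \<le> (\<integral>\<^sup>+x. ennreal \<kappa> * indicator ?I x \<partial>lborel)"
      using f by (intro nn_integral_mono mult_right_mono ennreal_leI) auto
    also have "\<dots> = ennreal \<kappa> * ennreal ((\<eta> - y) / c - (- \<eta> - y) / c)"
      using len by (simp add: nn_integral_cmult_indicator)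
    also have "(\<eta> - y) / c - (- \<eta> - y) / c = 2 * \<eta> / c" by (simp flip: diff_divide_distrib)
    also have "ennreal \<kappa> * ennreal (2 * \<eta> / c) = ennreal (2 * \<kappa> * \<eta> / c)"
      using \<open>0 \<le> \<kappa>\<close> c \<eta> by (subst ennreal_mult[symmetric]) (auto simp: mult_ac)
    finally show "emeasure (distr M borel X) ((\<lambda>x. (x, y)) -` S) \<le> ennreal (2 * \<kappa> * \<eta> / c)" .
  qed
  also have "\<dots> = ennreal (2 * \<kappa> * \<eta> / c)" by (simp add: Y.emeasure_space_1[simplified])
  finally show ?thesis .
qed

section \<open>Moments of the grid increments, and null events for the drifted Brownian path\<close>

locale brownian =
  fixes M :: "'a measure" and W :: "real \<Rightarrow> 'a \<Rightarrow> real"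
  assumes BM: "brownian_motion M W"

sublocale brownian \<subseteq> prob_space M
  using BM by (simp add: brownian_motion_def)

context brownian
begin

lemma W_0: "\<omega> \<in> space M \<Longrightarrow> W 0 \<omega> = 0"
  and W_cont: "\<omega> \<in> space M \<Longrightarrow> continuous_on {0..} (\<lambda>t. W t \<omega>)"
  using BM by (auto simp: brownian_motion_def)

lemma increment_distributed:
  "0 \<le> s \<Longrightarrow> s < t \<Longrightarrow> distributed M lborel (\<lambda>\<omega>. W t \<omega> - W s \<omega>)
    (\<lambda>x. ennreal (normal_density 0 (sqrt (t - s)) x))"
  using BM by (auto simp: brownian_motion_def)

lemma increments_indep:
  "0 \<le> ts 0 \<Longrightarrow> strict_mono ts \<Longrightarrow>
    indep_vars (\<lambda>_. borel) (\<lambda>i \<omega>. W (ts (Suc i)) \<omega> - W (ts i) \<omega>) {..<n}"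
  using BM by (auto simp: brownian_motion_def)

lemma W_measurable [measurable]:
  assumes "0 \<le> t"
  shows "W t \<in> borel_measurable M"
proof (cases "t = 0")
  case True
  then show ?thesis using W_0 by (subst measurable_cong[where g = "\<lambda>_. 0"]) auto
next
  case False
  then have "(\<lambda>\<omega>. W t \<omega> - W 0 \<omega>) \<in> borel_measurable M"
    using distributed_measurable[OF increment_distributed[of 0 t]] assms by simp
  then show ?thesis using W_0 by (subst measurable_cong[where g = "\<lambda>\<omega>. W t \<omega> - W 0 \<omega>"]) auto
qed

lemma increment_moment:
  assumes "0 \<le> s" "s < t"
  shows "(\<integral>\<^sup>+\<omega>. ennreal ((W t \<omega> - W s \<omega>)^(2 * k)) \<partial>M)
    = ennreal (fact (2 * k) / (2^k * fact k) * (t - s)^k)"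
proof -
  let ?\<sigma> = "sqrt (t - s)"
  have nonneg: "0 \<le> x^(2 * k)" for x :: real by (simp add: power_mult)
  have mom: "has_bochner_integral lborel (\<lambda>x. normal_density 0 ?\<sigma> x * (x - 0)^(2 * k))
      (fact (2 * k) / ((2 / ?\<sigma>\<^sup>2)^k * fact k))"
    using assms by (intro normal_moment_even) simp
  have "(\<integral>\<^sup>+\<omega>. ennreal ((W t \<omega> - W s \<omega>)^(2 * k)) \<partial>M)
      = (\<integral>\<^sup>+x. ennreal (normal_density 0 ?\<sigma> x) * ennreal (x^(2 * k)) \<partial>lborel)"
    by (rule distributed_nn_integral[OF increment_distributed[OF assms], symmetric]) simp
  also have "\<dots> = (\<integral>\<^sup>+x. ennreal (normal_density 0 ?\<sigma> x * (x - 0)^(2 * k)) \<partial>lborel)"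
    using nonneg by (simp add: ennreal_mult)
  also have "\<dots> = ennreal (fact (2 * k) / ((2 / ?\<sigma>\<^sup>2)^k * fact k))"
    using mom nonneg
    by (subst nn_integral_eq_integral) (auto simp: has_bochner_integral_iff)
  also have "fact (2 * k) / ((2 / ?\<sigma>\<^sup>2)^k * fact k) = fact (2 * k) / (2^k * fact k) * (t - s)^k"
    using assms by (simp add: power_divide)
  finally show ?thesis .
qed

text \<open>\<open>Z\<close> is the sum of all these powers. The eighth moment of a centred Gaussian
  of variance v is 105 v^4, where 105 = 8! / (2^4 4!); with v = L / 8^n and the factor 2^(8 n) this
  is 105 L^4 / 16^n. The 8^n increments of level \<open>n\<close> then contribute 105 L^4 /
  2^n.\<close>

lemma grid_increments_dominated:
  assumes L: "0 < L"
  obtains Z :: "'a \<Rightarrow> ennreal" where "Z \<in> borel_measurable M" "(\<integral>\<^sup>+\<omega>. Z \<omega> \<partial>M) < \<infinity>"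
    "\<And>\<omega> n j. j < 8^n \<Longrightarrow>
      ennreal ((2^n * (W (L * ((real j + 1) / 8^n)) \<omega> - W (L * (real j / 8^n)) \<omega>))^8) \<le> Z \<omega>"
proof -
  define d where "d n j \<omega> = ennreal ((2^n * (W (L * ((real j + 1) / 8^n)) \<omega> - W (L * (real j / 8^n)) \<omega>))^8)"
    for n j \<omega>
  define Z where "Z \<omega> = (\<Sum>n. \<Sum>j<8^n. d n j \<omega>)" for \<omega>
  have [measurable]: "d n j \<in> borel_measurable M" for n j
    unfolding d_def using L
    by (intro measurable_compose[OF _ measurable_ennreal] borel_measurable_power borel_measurable_times
        borel_measurable_diff borel_measurable_const W_measurable) auto
  have [measurable]: "Z \<in> borel_measurable M" unfolding Z_def by measurable
  have mom: "(\<integral>\<^sup>+\<omega>. d n j \<omega> \<partial>M) = ennreal (105 * L^4 * (1/16)^n)" for n j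
  proof -
    let ?s = "L * (real j / 8^n)" and ?t = "L * ((real j + 1) / 8^n)"
    have diff: "?t - ?s = L / 8^n" by (simp add: field_simps)
    have st: "0 \<le> ?s" "?s < ?t"
    proof -
      show "0 \<le> ?s" using L by simp
      have "0 < ?t - ?s" unfolding diff using L by simp
      then show "?s < ?t" by simp
    qed
    have "d n j \<omega> = ennreal ((2^n)^8) * ennreal ((W ?t \<omega> - W ?s \<omega>)^(2 * 4))" for \<omega>
      unfolding d_def by (subst ennreal_mult[symmetric]) (auto simp: power_mult_distrib zero_le_even_power)
    then have "(\<integral>\<^sup>+\<omega>. d n j \<omega> \<partial>M)
        = (\<integral>\<^sup>+\<omega>. ennreal ((2^n)^8) * ennreal ((W ?t \<omega> - W ?s \<omega>)^(2 * 4)) \<partial>M)"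
      by (simp only:)
    also have "\<dots> = ennreal ((2^n)^8) * (\<integral>\<^sup>+\<omega>. ennreal ((W ?t \<omega> - W ?s \<omega>)^(2 * 4)) \<partial>M)"
      using st by (intro nn_integral_cmult) (auto intro!: measurable_compose[OF _ measurable_ennreal] borel_measurable_power borel_measurable_diff W_measurable)
    also have "\<dots> = ennreal ((2^n)^8) * ennreal (fact (2 * 4) / (2^4 * fact 4) * (?t - ?s)^4)"
      by (simp only: increment_moment[OF st])
    also have "\<dots> = ennreal ((2^n)^8 * (fact (2 * 4) / (2^4 * fact 4) * (?t - ?s)^4))"
      using st by (subst ennreal_mult) auto
    also have "(2^n)^8 * (fact (2 * 4) / (2^4 * fact 4) * (?t - ?s)^4) = 105 * L^4 * ((2^n)^8 / (8^n)^4)"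
      unfolding diff by (simp add: fact_numeral power_divide)
    also have "((2::real)^n)^8 / (8^n)^4 = (1/16)^n"
    proof -
      have "((2::real)^n)^8 = (2^8)^n" "((8::real)^n)^4 = (8^4)^n"
        by (simp_all only: power_mult[symmetric] mult.commute)
      then show ?thesis by (simp only: power_divide[symmetric]) simp
    qed
    finally show ?thesis .
  qed
  have "(\<integral>\<^sup>+\<omega>. Z \<omega> \<partial>M) = (\<Sum>n. \<Sum>j<(8::nat)^n. ennreal (105 * L^4 * (1/16)^n))"
    unfolding Z_def by (simp add: nn_integral_suminf nn_integral_sum mom)
  also have "\<dots> = (\<Sum>n. ennreal (105 * L^4 * (1/2)^n))"
  proof (rule suminf_cong)
    fix n
    have "(\<Sum>j<(8::nat)^n. ennreal (105 * L^4 * (1/16)^n)) = ennreal (\<Sum>j<(8::nat)^n. 105 * L^4 * (1/16)^n)"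
      using L by (intro sum_ennreal) auto
    also have "(\<Sum>j<(8::nat)^n. 105 * L^4 * (1/16)^n) = 105 * L^4 * (8^n * (1/16)^n)" by simp
    also have "(8::real)^n * (1/16)^n = (1/2)^n" by (simp add: power_mult_distrib[symmetric])
    finally show "(\<Sum>j<(8::nat)^n. ennreal (105 * L^4 * (1/16)^n)) = ennreal (105 * L^4 * (1/2)^n)" .
  qed
  also have "\<dots> = ennreal (\<Sum>n. 105 * L^4 * (1/2)^n)"
    using L by (intro suminf_ennreal2 summable_mult summable_geometric) auto
  finally have "(\<integral>\<^sup>+\<omega>. Z \<omega> \<partial>M) < \<infinity>" by simp
  moreover have "d n j \<omega> \<le> Z \<omega>" if "j < 8^n" for n j \<omega>
  proof -
    have "d n j \<omega> \<le> (\<Sum>j<8^n. d n j \<omega>)"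
      using that by (intro member_le_sum) auto
    also have "\<dots> \<le> Z \<omega>"
      unfolding Z_def using sum_le_suminf[of "\<lambda>n. \<Sum>j<8^n. d n j \<omega>" "{n}"] by simp
    finally show ?thesis .
  qed
  ultimately show ?thesis using that[of Z] by (auto simp: d_def)
qed

text \<open>Chebyshev along integer times: staying below \<open>a\<close> at a large time
  \<open>n\<close> forces \<open>W n\<close> below -m n / (2 D0), an event of probability O(1 / n).
  A path not below \<open>a\<close> at some integer time hits it by the intermediate value
  theorem.\<close>

lemma AE_level_hit:
  assumes m: "0 < m" and D0: "0 < D0" and a: "0 < a"
  shows "AE \<omega> in M. \<exists>t>0. m * t + D0 * W t \<omega> = a"
proof -
  define N where "N = {\<omega> \<in> space M. \<forall>n::nat. m * real n + D0 * W (real n) \<omega> < a}"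
  have N[measurable]: "N \<in> sets M" unfolding N_def by measurable
  have bound: "emeasure M N \<le> ennreal (4 * D0\<^sup>2 / m\<^sup>2 * (1 / real n))" if n: "1 \<le> n" "2 * a \<le> m * real n" for n
  proof -
    define c where "c = m * real n / (2 * D0)"
    have c: "0 < c" using m D0 n by (simp add: c_def)
    have sub: "indicator N \<omega> \<le> ennreal (1 / c\<^sup>2) * ennreal ((W (real n) \<omega> - W 0 \<omega>)^(2 * 1))"
      if "\<omega> \<in> space M" for \<omega>
    proof (cases "\<omega> \<in> N")
      case True
      then have "D0 * W (real n) \<omega> < a - m * real n" by (simp add: N_def algebra_simps)
      also have "\<dots> \<le> - (m * real n / 2)" using n by simp
      finally have "c \<le> - W (real n) \<omega>" using D0 by (simp add: c_def field_simps)
      then have "c\<^sup>2 \<le> (- W (real n) \<omega>)\<^sup>2" using c by (intro power_mono) auto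
      then have "1 \<le> 1 / c\<^sup>2 * (W (real n) \<omega>)\<^sup>2" using c by (simp add: field_simps)
      then have "ennreal 1 \<le> ennreal (1 / c\<^sup>2 * (W (real n) \<omega>)\<^sup>2)" by (rule ennreal_leI)
      also have "\<dots> = ennreal (1 / c\<^sup>2) * ennreal ((W (real n) \<omega>)\<^sup>2)"
        by (rule ennreal_mult) auto
      finally show ?thesis using True W_0[OF that] by simp
    qed simp
    have "emeasure M N = (\<integral>\<^sup>+\<omega>. indicator N \<omega> \<partial>M)" by simp
    also have "\<dots> \<le> (\<integral>\<^sup>+\<omega>. ennreal (1 / c\<^sup>2) * ennreal ((W (real n) \<omega> - W 0 \<omega>)^(2 * 1)) \<partial>M)"
      by (rule nn_integral_mono) (rule sub)
    also have "\<dots> = ennreal (1 / c\<^sup>2) * (\<integral>\<^sup>+\<omega>. ennreal ((W (real n) \<omega> - W 0 \<omega>)^(2 * 1)) \<partial>M)"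
      by (rule nn_integral_cmult) measurable
    also have "\<dots> = ennreal (1 / c\<^sup>2) * ennreal (fact (2 * 1) / (2^1 * fact 1) * (real n - 0)^1)"
      using n by (subst increment_moment) auto
    also have "\<dots> = ennreal (1 / c\<^sup>2 * real n)"
      by (subst ennreal_mult) (auto simp: fact_numeral)
    also have "1 / c\<^sup>2 * real n = 4 * D0\<^sup>2 / m\<^sup>2 * (1 / real n)"
      using m D0 n by (simp add: c_def field_simps power2_eq_square)
    finally show ?thesis .
  qed
  have "emeasure M N \<le> ennreal 0"
  proof (rule tendsto_lowerbound)
    have "(\<lambda>n. 4 * D0\<^sup>2 / m\<^sup>2 * (1 / real n)) \<longlonglongrightarrow> 4 * D0\<^sup>2 / m\<^sup>2 * 0"
      by (intro tendsto_intros lim_1_over_n)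
    then show "(\<lambda>n. ennreal (4 * D0\<^sup>2 / m\<^sup>2 * (1 / real n))) \<longlonglongrightarrow> ennreal 0"
      by (intro tendsto_ennrealI) simp
    obtain k where k: "2 * a < real k * m" using reals_Archimedean3[OF m] by blast
    show "\<forall>\<^sub>F n in sequentially. emeasure M N \<le> ennreal (4 * D0\<^sup>2 / m\<^sup>2 * (1 / real n))"
      using eventually_ge_at_top[of "max 1 k"]
    proof eventually_elim
      case (elim n)
      have "real k * m \<le> real n * m" using elim m by (intro mult_right_mono) auto
      then show ?case using k elim by (intro bound) (auto simp: mult.commute)
    qed
  qed simp
  then have "N \<in> null_sets M" by (auto simp: null_sets_def)
  then show ?thesis
  proof (rule AE_I')
    show "{\<omega> \<in> space M. \<not> (\<exists>t>0. m * t + D0 * W t \<omega> = a)} \<subseteq> N"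
    proof
      fix \<omega> assume \<omega>: "\<omega> \<in> {\<omega> \<in> space M. \<not> (\<exists>t>0. m * t + D0 * W t \<omega> = a)}"
      show "\<omega> \<in> N"
      proof (rule ccontr)
        assume "\<omega> \<notin> N"
        then obtain n :: nat where n: "a \<le> m * real n + D0 * W (real n) \<omega>"
          using \<omega> by (auto simp: N_def not_less)
        have "continuous_on {0..real n} (\<lambda>t. m * t + D0 * W t \<omega>)"
          using \<omega> by (intro continuous_intros continuous_on_subset[OF W_cont]) auto
        then obtain t where t: "0 \<le> t" "m * t + D0 * W t \<omega> = a"
          using IVT'[of "\<lambda>t. m * t + D0 * W t \<omega>" 0 a "real n"] n a W_0[of \<omega>] \<omega> by auto
        moreover have "t \<noteq> 0" using t a W_0[of \<omega>] \<omega> by auto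
        ultimately have "\<exists>t>0. m * t + D0 * W t \<omega> = a" by (intro exI[of _ t]) simp
        then show False using \<omega> by blast
      qed
    qed
  qed
qed

lemma AE_not_at_level:
  assumes D0: "0 < D0" and t: "0 < t"
  shows "AE \<omega> in M. m * t + D0 * W t \<omega> \<noteq> a"
proof -
  let ?c = "(a - m * t) / D0"
  have "emeasure M ((\<lambda>\<omega>. W t \<omega> - W 0 \<omega>) -` {?c} \<inter> space M)
      = (\<integral>\<^sup>+x. ennreal (normal_density 0 (sqrt (t - 0)) x) * indicator {?c} x \<partial>lborel)"
    using t by (intro distributed_emeasure[OF increment_distributed]) auto
  also have "\<dots> = 0" by simp
  finally have "(\<lambda>\<omega>. W t \<omega> - W 0 \<omega>) -` {?c} \<inter> space M \<in> null_sets M"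
    using t by (auto simp: null_sets_def)
  then show ?thesis
    by (rule AE_I') (use D0 W_0 in \<open>auto simp: field_simps\<close>)
qed

text \<open>The maximum over \<open>[s, t]\<close> is the value at \<open>s\<close> plus a functional of the increments after \<open>s\<close>;
  the two are independent and the former has a bounded density.\<close>

lemma grid_maximum_small_ball:
  assumes D0: "0 < D0" and s: "0 < s" and h: "0 < h" and \<eta>: "0 \<le> \<eta>"
  shows "emeasure M {\<omega> \<in> space M.
      \<bar>Max ((\<lambda>j. m * (s + real j * h) + D0 * W (s + real j * h) \<omega>) ` {..n}) - a\<bar> \<le> \<eta>}
    \<le> ennreal (2 * (1 / sqrt (2 * pi * s)) * \<eta> / D0)"
proof -
  \<comment> \<open>The time 0 is put in front of the grid, so that increment number 0 is
    \<open>W s\<close> and the others live after \<open>s\<close>.\<close>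
  define ts where "ts i = (case i of 0 \<Rightarrow> 0 | Suc j \<Rightarrow> s + real j * h)" for i :: nat
  have ts: "ts 0 = 0" "ts (Suc j) = s + real j * h" for j by (simp_all add: ts_def)
  define X where "X i \<omega> = W (ts (Suc i)) \<omega> - W (ts i) \<omega>" for i \<omega>
  have "strict_mono ts"
    unfolding strict_mono_Suc_iff using s h by (auto simp: ts_def distrib_right split: nat.split)
  then have ind: "indep_vars (\<lambda>_. borel) X {..<Suc n}"
    unfolding X_def[abs_def] by (intro increments_indep) (auto simp: ts)
  \<comment> \<open>The grid maximum minus \<open>a\<close>, with the contribution of
    \<open>W s\<close> removed: a function of the increments 1 to \<open>n\<close> only.\<close>
  define F where "F x = Max ((\<lambda>j. m * (s + real j * h) + D0 * (\<Sum>i\<in>{1..j}. x i)) ` {..n}) - a"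
    for x :: "nat \<Rightarrow> real"
  have F_meas: "F \<in> borel_measurable (Pi\<^sub>M {1..n} (\<lambda>_. borel))"
    unfolding F_def
    by (intro borel_measurable_diff borel_measurable_Max borel_measurable_add borel_measurable_times
        borel_measurable_const borel_measurable_sum measurable_component_singleton) auto
  have "indep_var borel ((\<lambda>x. x 0) \<circ> (\<lambda>\<omega>. restrict (\<lambda>i. X i \<omega>) {0}))
      borel (F \<circ> (\<lambda>\<omega>. restrict (\<lambda>i. X i \<omega>) {1..n}))"
    by (rule indep_var_compose[OF indep_var_restrict[OF ind, of "{0}" "{1..n}"] _ F_meas])
      (auto intro: measurable_component_singleton)
  moreover have "(\<lambda>x. x 0) \<circ> (\<lambda>\<omega>. restrict (\<lambda>i. X i \<omega>) {0}) = X 0"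
    by (auto simp: fun_eq_iff)
  ultimately have indep: "indep_var borel (X 0) borel (F \<circ> (\<lambda>\<omega>. restrict (\<lambda>i. X i \<omega>) {1..n}))"
    by simp
  have dist: "distributed M lborel (X 0) (\<lambda>x. ennreal (normal_density 0 (sqrt s) x))"
    using increment_distributed[of 0 s] s by (simp add: X_def[abs_def] ts)
  have dens: "normal_density 0 (sqrt s) x \<le> 1 / sqrt (2 * pi * s)" for x
    using s by (auto simp: normal_density_def intro!: divide_right_mono)
  have tele: "W (s + real j * h) \<omega> - W s \<omega> = (\<Sum>i\<in>{1..j}. X i \<omega>)" for j \<omega>
    by (induction j) (auto simp: X_def ts)
  have "Max ((\<lambda>j. m * (s + real j * h) + D0 * W (s + real j * h) \<omega>) ` {..n}) - a
      = D0 * X 0 \<omega> + (F \<circ> (\<lambda>\<omega>. restrict (\<lambda>i. X i \<omega>) {1..n})) \<omega>" if "\<omega> \<in> space M" for \<omega>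
  proof -
    let ?g = "\<lambda>j. m * (s + real j * h) + D0 * (\<Sum>i\<in>{1..j}. X i \<omega>)"
    have X0: "X 0 \<omega> = W s \<omega>" using W_0[OF that] by (simp add: X_def ts)
    have "(\<lambda>j. m * (s + real j * h) + D0 * W (s + real j * h) \<omega>) ` {..n} = (\<lambda>j. ?g j + D0 * X 0 \<omega>) ` {..n}"
    proof (intro image_cong refl)
      fix j
      have "W (s + real j * h) \<omega> = W s \<omega> + (\<Sum>i\<in>{1..j}. X i \<omega>)" using tele[of j \<omega>] by linarith
      then show "m * (s + real j * h) + D0 * W (s + real j * h) \<omega> = ?g j + D0 * X 0 \<omega>"
        by (simp add: X0 distrib_left)
    qed
    also have "Max \<dots> = Max (?g ` {..n}) + D0 * X 0 \<omega>"
      by (rule Max_add_commute) auto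
    also have "?g ` {..n} = (\<lambda>j. m * (s + real j * h) + D0 * (\<Sum>i\<in>{1..j}. restrict (\<lambda>i. X i \<omega>) {1..n} i)) ` {..n}"
      by (intro image_cong refl arg_cong2[where f = "(+)"] arg_cong2[where f = "(*)"] sum.cong) auto
    finally show ?thesis by (simp add: F_def)
  qed
  then have "{\<omega> \<in> space M.
      \<bar>Max ((\<lambda>j. m * (s + real j * h) + D0 * W (s + real j * h) \<omega>) ` {..n}) - a\<bar> \<le> \<eta>}
    = {\<omega> \<in> space M. \<bar>D0 * X 0 \<omega> + (F \<circ> (\<lambda>\<omega>. restrict (\<lambda>i. X i \<omega>) {1..n})) \<omega>\<bar> \<le> \<eta>}"
    by (intro Collect_cong conj_cong refl) simp
  then show ?thesis
    using indep_small_ball[OF indep dist dens D0 \<eta>] by simp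
qed

text \<open>If the maximum over \<open>[s, t]\<close> is \<open>a\<close>, the grid maxima
  \<open>A n\<close> converge to \<open>a\<close> by continuity, so the path lies in
  \<open>S \<eta>\<close> for every \<eta> > 0. The small ball bound is uniform in the grid and
  hence survives in \<open>S \<eta>\<close>; letting \<eta> tend to 0 leaves a null set. Positivity
  of \<open>s\<close> is what gives \<open>W s\<close> a bounded density.\<close>

lemma AE_maximum_not_at_level:
  assumes D0: "0 < D0" and s: "0 < s" "s < t"
  shows "AE \<omega> in M. \<not> (\<exists>x\<in>{s..t}. m * x + D0 * W x \<omega> = a \<and> (\<forall>y\<in>{s..t}. m * y + D0 * W y \<omega> \<le> a))"
proof -
  define h where "h n = (t - s) / real (Suc n)" for n
  have h: "0 < h n" for n using s by (simp add: h_def)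
  define A where "A n \<omega> = Max ((\<lambda>j. m * (s + real j * h n) + D0 * W (s + real j * h n) \<omega>) ` {..Suc n})"
    for n \<omega>
  have A_meas[measurable]: "A n \<in> borel_measurable M" for n
    unfolding A_def using s h[of n]
    by (intro borel_measurable_Max borel_measurable_add borel_measurable_times
        borel_measurable_const W_measurable) auto
  define B where "B \<eta> n = {\<omega> \<in> space M. \<bar>A n \<omega> - a\<bar> \<le> \<eta>}" for \<eta> n
  have B_meas[measurable]: "B \<eta> n \<in> sets M" for \<eta> n unfolding B_def by measurable
  define c where "c = 2 * (1 / sqrt (2 * pi * s)) / D0"
  define S where "S \<eta> = (\<Union>N. \<Inter>n\<in>{N..}. B \<eta> n)" for \<eta>
  have S_meas[measurable]: "S \<eta> \<in> sets M" for \<eta> unfolding S_def by measurable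
  have S_le: "emeasure M (S \<eta>) \<le> ennreal (c * \<eta>)" if "0 \<le> \<eta>" for \<eta>
  proof -
    have "incseq (\<lambda>N. \<Inter>n\<in>{N..}. B \<eta> n)" by (auto simp: incseq_def)
    then have "emeasure M (S \<eta>) = (SUP N. emeasure M (\<Inter>n\<in>{N..}. B \<eta> n))"
      unfolding S_def by (intro SUP_emeasure_incseq[symmetric]) auto
    also have "\<dots> \<le> ennreal (c * \<eta>)"
    proof (rule SUP_least)
      fix N
      have "emeasure M (\<Inter>n\<in>{N..}. B \<eta> n) \<le> emeasure M (B \<eta> N)"
        by (rule emeasure_mono) auto
      also have "\<dots> \<le> ennreal (c * \<eta>)"
        using grid_maximum_small_ball[OF D0 s(1) h[of N] that, of m "Suc N" a]
        by (simp add: B_def A_def c_def)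
      finally show "emeasure M (\<Inter>n\<in>{N..}. B \<eta> n) \<le> ennreal (c * \<eta>)" .
    qed
    finally show ?thesis .
  qed
  define N where "N = (\<Inter>p. S (1 / real (Suc p)))"
  have "N \<in> sets M" unfolding N_def by measurable
  moreover have "emeasure M N \<le> ennreal 0"
  proof (rule tendsto_lowerbound)
    have "(\<lambda>p. c * (1 / real (Suc p))) \<longlonglongrightarrow> c * 0"
      by (intro tendsto_intros LIMSEQ_Suc[OF lim_1_over_n])
    then show "(\<lambda>p. ennreal (c * (1 / real (Suc p)))) \<longlonglongrightarrow> ennreal 0"
      by (intro tendsto_ennrealI) simp
    have "emeasure M N \<le> ennreal (c * (1 / real (Suc p)))" for p
      by (rule order_trans[OF emeasure_mono S_le]) (auto simp: N_def)
    then show "\<forall>\<^sub>F p in sequentially. emeasure M N \<le> ennreal (c * (1 / real (Suc p)))" by simp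
  qed simp
  ultimately have "N \<in> null_sets M" by (auto simp: null_sets_def)
  then show ?thesis
  proof (rule AE_I')
    show "{\<omega> \<in> space M. \<not> \<not> (\<exists>x\<in>{s..t}. m * x + D0 * W x \<omega> = a \<and>
        (\<forall>y\<in>{s..t}. m * y + D0 * W y \<omega> \<le> a))} \<subseteq> N"
    proof
      fix \<omega> assume "\<omega> \<in> {\<omega> \<in> space M. \<not> \<not> (\<exists>x\<in>{s..t}. m * x + D0 * W x \<omega> = a \<and>
        (\<forall>y\<in>{s..t}. m * y + D0 * W y \<omega> \<le> a))}"
      then obtain x where \<omega>: "\<omega> \<in> space M" and x: "x \<in> {s..t}" "m * x + D0 * W x \<omega> = a"
        and ub: "\<And>y. y \<in> {s..t} \<Longrightarrow> m * y + D0 * W y \<omega> \<le> a" by auto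
      have "\<omega> \<in> S \<eta>" if \<eta>: "0 < \<eta>" for \<eta>
      proof -
        have "continuous_on {s..t} (\<lambda>y. m * y + D0 * W y \<omega>)"
          using \<omega> s by (intro continuous_intros continuous_on_subset[OF W_cont]) auto
        then obtain d where d: "0 < d"
          "\<And>y. y \<in> {s..t} \<Longrightarrow> dist y x < d \<Longrightarrow> dist (m * y + D0 * W y \<omega>) a < \<eta>"
          unfolding continuous_on_iff using x \<eta> by metis
        obtain N where N: "(t - s) / d < real N" using reals_Archimedean2 by blast
        have "\<omega> \<in> B \<eta> n" if n: "N \<le> n" for n
        proof -
          have grid: "s + real j * h n \<in> {s..t}" if "j \<le> Suc n" for j
          proof -
            have "real j * h n \<le> real (Suc n) * h n" using that h[of n] by (intro mult_right_mono) auto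
            moreover have "real (Suc n) * h n = t - s" by (simp add: h_def)
            moreover have "0 \<le> real j * h n" using h[of n] by simp
            ultimately show ?thesis by simp
          qed
          \<comment> \<open>The grid point at or just left of the maximiser \<open>x\<close>; it
            lies within one mesh \<open>h n\<close> of \<open>x\<close>.\<close>
          define j where "j = nat \<lfloor>(x - s) / h n\<rfloor>"
          have j: "real j \<le> (x - s) / h n" "(x - s) / h n < real j + 1"
            using x h[of n] by (auto simp: j_def)
          have "(x - s) / h n \<le> (t - s) / h n" using x h[of n] by (intro divide_right_mono) auto
          also have "\<dots> = real (Suc n)" using s by (simp add: h_def)
          finally have jn: "j \<le> Suc n" using j(1) by linarith
          have "(t - s) / d < real (Suc n)" using N n by linarith
          then have hd: "h n < d" using d(1) by (simp add: h_def field_simps)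
          have "real j * h n \<le> x - s" "x - s < real j * h n + h n"
            using j h[of n] by (simp_all add: field_simps)
          then have "dist (s + real j * h n) x < d" using hd by (simp add: dist_real_def)
          from d(2)[OF grid[OF jn] this]
          have "a - \<eta> < m * (s + real j * h n) + D0 * W (s + real j * h n) \<omega>"
            by (simp add: dist_real_def abs_less_iff)
          also have "\<dots> \<le> A n \<omega>" unfolding A_def using jn by (intro Max_ge) auto
          finally have "a - \<eta> < A n \<omega>" .
          moreover have "A n \<omega> \<le> a" unfolding A_def using ub grid by (subst Max_le_iff) auto
          ultimately show ?thesis using \<omega> by (simp add: B_def)
        qed
        then show ?thesis by (auto simp: S_def)
      qed
      then show "\<omega> \<in> N" by (auto simp: N_def)
    qed
  qed
qed

end

section \<open>Test functions, strict crossing at hitting times, and the mean square limit\<close>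

lemma
  assumes "test_fun_pos \<phi>"
  shows test_fun_pos_continuous: "continuous_on UNIV \<phi>"
    and test_fun_pos_eq_0: "t \<le> 0 \<Longrightarrow> \<phi> t = 0"
    and test_fun_pos_bounded: "\<exists>\<Phi>. \<forall>t. \<bar>\<phi> t\<bar> \<le> \<Phi>"
proof -
  obtain a c where ac: "0 < a" "a \<le> c" "\<And>x. x \<notin> {a..c} \<Longrightarrow> \<phi> x = 0"
    using assms by (auto simp: test_fun_pos_def)
  have "((deriv ^^ 0) \<phi>) differentiable (at x)" for x
    using assms unfolding test_fun_pos_def by blast
  then have "\<phi> differentiable (at x)" for x by simp
  then show cont: "continuous_on UNIV \<phi>"
    by (intro continuous_at_imp_continuous_on ballI differentiable_imp_continuous_within)
  show "\<phi> t = 0" if "t \<le> 0" using ac(1) ac(3)[of t] that by auto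
  have "continuous_on {a..c} (\<lambda>x. \<bar>\<phi> x\<bar>)"
    by (intro continuous_intros continuous_on_subset[OF cont]) auto
  then obtain y where y: "\<And>x. x \<in> {a..c} \<Longrightarrow> \<bar>\<phi> x\<bar> \<le> \<bar>\<phi> y\<bar>"
    using continuous_attains_sup[of "{a..c}" "\<lambda>x. \<bar>\<phi> x\<bar>"] ac(2) by force
  have "\<bar>\<phi> x\<bar> \<le> \<bar>\<phi> y\<bar>" for x using y[of x] ac(3)[of x] by (cases "x \<in> {a..c}") auto
  then show "\<exists>\<Phi>. \<forall>t. \<bar>\<phi> t\<bar> \<le> \<Phi>" by blast
qed

text \<open>If the path stayed at or below \<open>a\<close> just after hitting it, then
  \<open>a\<close> would be its maximum over some interval with rational endpoints around the
  hitting time. Each such event is null and there are countably many; the left endpoint can be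
  positive because the hitting time is.\<close>

lemma (in brownian) AE_crossing:
  assumes m: "0 < m" and D0: "0 < D0" and a: "0 < a"
  shows "AE \<omega> in M. \<forall>x>hit_time (\<lambda>t. m * t + D0 * W t \<omega>) a.
    \<exists>u\<in>{hit_time (\<lambda>t. m * t + D0 * W t \<omega>) a<..<x}. a < m * u + D0 * W u \<omega>"
proof -
  let ?P = "\<lambda>s t \<omega>. \<exists>x\<in>{s..t}. m * x + D0 * W x \<omega> = a \<and> (\<forall>y\<in>{s..t}. m * y + D0 * W y \<omega> \<le> a)"
  have "AE \<omega> in M. \<forall>s t :: rat. 0 < real_of_rat s \<and> real_of_rat s < real_of_rat t \<longrightarrow>
      \<not> ?P (real_of_rat s) (real_of_rat t) \<omega>"
    unfolding AE_all_countable using AE_maximum_not_at_level[OF D0] by (auto intro: AE_impI)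
  then show ?thesis using AE_level_hit[OF m D0 a] AE_space
  proof eventually_elim
    case (elim \<omega>)
    let ?E = "\<lambda>t. m * t + D0 * W t \<omega>"
    have cont: "continuous_on {0..} ?E"
      using W_cont[OF elim(3)] by (intro continuous_intros)
    have E0: "?E 0 = 0" using W_0[OF elim(3)] by simp
    define \<tau> where "\<tau> = hit_time ?E a"
    have \<tau>: "0 < \<tau>" "?E \<tau> = a" "\<And>x. 0 \<le> x \<Longrightarrow> x < \<tau> \<Longrightarrow> ?E x < a"
      unfolding \<tau>_def
      by (rule hit_time_pos[OF cont E0 a elim(2)] at_hit_time[OF cont E0 a elim(2)]
          before_hit_time[OF cont E0 a elim(2)], assumption?)+
    have "\<exists>u\<in>{\<tau><..<x}. a < ?E u" if x: "\<tau> < x" for x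
    proof (rule ccontr)
      assume no: "\<not> (\<exists>u\<in>{\<tau><..<x}. a < ?E u)"
      obtain s where s: "0 < real_of_rat s" "real_of_rat s < \<tau>" using of_rat_dense[OF \<tau>(1)] by auto
      obtain t where t: "\<tau> < real_of_rat t" "real_of_rat t < x" using of_rat_dense[OF x] by auto
      have "?E y \<le> a" if "y \<in> {real_of_rat s..real_of_rat t}" for y
      proof (cases y \<tau> rule: linorder_cases)
        case less
        moreover have "0 \<le> y" using that s(1) unfolding atLeastAtMost_iff by linarith
        ultimately show ?thesis using \<tau>(3)[of y] by simp
      next
        case greater
        then have "y \<in> {\<tau><..<x}" using that t by simp
        then show ?thesis using no by (auto simp: not_less)
      qed (use \<tau>(2) in simp)
      then have "?P (real_of_rat s) (real_of_rat t) \<omega>"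
        using \<tau>(2) s t by (intro bexI[of _ \<tau>]) auto
      then show False using elim(1) s t by force
    qed
    then show ?case unfolding \<tau>_def by blast
  qed
qed

theorem theorem2:
  fixes M :: "'a measure" and W :: "real \<Rightarrow> 'a \<Rightarrow> real"
    and q sig :: "real \<Rightarrow> real \<Rightarrow> 'a \<Rightarrow> real"
    and m r b D0 D1 T :: real and \<phi> :: "real \<Rightarrow> real"
  assumes BM: "brownian_motion M W"
    and m: "0 < m" and r: "0 < r" and b: "0 < b"
    and D: "0 < D0" "D0 \<le> D1" and T: "0 \<le> T"
    and phi: "test_fun_pos \<phi>"
    and sol: "\<And>\<epsilon> \<omega>. 0 < \<epsilon> \<Longrightarrow> \<omega> \<in> space M \<Longrightarrow>
       switching_solution m r b D0 D1 T \<epsilon> (\<lambda>t. W t \<omega>) (\<lambda>t. q \<epsilon> t \<omega>) (\<lambda>t. sig \<epsilon> t \<omega>)"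
  shows "((\<lambda>\<epsilon>. \<integral>\<^sup>+ \<omega>. ennreal
            (((LBINT t:{0<..}. sig \<epsilon> t \<omega> * \<phi> t)
              - b * (\<Sum>i\<in>{1..count_hits (\<lambda>t. m * t + D0 * W t \<omega>) b T}.
                       \<phi> (hit_time (\<lambda>t. m * t + D0 * W t \<omega>) (real i * b)))) ^ 2) \<partial>M)
          \<longlongrightarrow> 0) (at_right 0)"
proof -
  interpret brownian M W using BM by unfold_locales
  define E where "E \<omega> t = m * t + D0 * W t \<omega>" for \<omega> t
  define err where "err \<epsilon> \<omega> = (LBINT t:{0<..}. sig \<epsilon> t \<omega> * \<phi> t)
      - b * (\<Sum>i\<in>{1..count_hits (E \<omega>) b T}. \<phi> (hit_time (E \<omega>) (real i * b)))" for \<epsilon> \<omega>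
  note \<phi> = test_fun_pos_continuous[OF phi] test_fun_pos_eq_0[OF phi]
  obtain \<Phi> where \<Phi>: "\<And>t. \<bar>\<phi> t\<bar> \<le> \<Phi>" using test_fun_pos_bounded[OF phi] by blast
  \<comment> \<open>\<open>T + 1\<close> serves as a positive horizon also when
    \<open>T = 0\<close>.\<close>
  have L: "T \<le> T + 1" "0 < T + 1" using T by auto
  obtain Z :: "'a \<Rightarrow> ennreal" where Z_meas[measurable]: "Z \<in> borel_measurable M"
    and Z_fin: "(\<integral>\<^sup>+\<omega>. Z \<omega> \<partial>M) < \<infinity>"
    and Z: "\<And>\<omega> n j. j < 8^n \<Longrightarrow>
      ennreal ((2^n * (W ((T + 1) * ((real j + 1) / 8^n)) \<omega> - W ((T + 1) * (real j / 8^n)) \<omega>))^8) \<le> Z \<omega>"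
    using grid_increments_dominated[OF L(2)] by blast
  define C where "C = \<Phi> * (8 * (1 + (15 * D0 + m * (T + 1)) / b)^3 * (b + 30 * D1)
      + (m * (T + 1) + 15 * D0))"
  have hit: "AE \<omega> in M. \<forall>k. 1 \<le> k \<longrightarrow> (\<exists>t>0. E \<omega> t = real k * b)"
    unfolding AE_all_countable E_def using AE_level_hit[OF m D(1)] b by (auto intro!: AE_impI)
  have cross: "AE \<omega> in M. \<forall>k. 1 \<le> k \<longrightarrow> (\<forall>x>hit_time (E \<omega>) (real k * b).
      \<exists>u\<in>{hit_time (E \<omega>) (real k * b)<..<x}. real k * b < E \<omega> u)"
    unfolding AE_all_countable E_def[abs_def] using AE_crossing[OF m D(1)] b by (auto intro!: AE_impI)
  \<comment> \<open>At time 0 there is no density to appeal to; instead \<open>E\<close> is 0 there,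
    below every level k b with k \<ge> 1.\<close>
  have E_T: "AE \<omega> in M. \<forall>k. 1 \<le> k \<longrightarrow> E \<omega> T \<noteq> real k * b"
  proof (cases "T = 0")
    case True
    show ?thesis
      using AE_space
    proof eventually_elim
      case (elim \<omega>)
      then show ?case using W_0[OF elim] True b by (auto simp: E_def)
    qed
  next
    case False
    then show ?thesis
      unfolding AE_all_countable E_def using AE_not_at_level[OF D(1), of T] T by (auto intro!: AE_impI)
  qed
  have family: "energy_path_family m b D0 T (\<lambda>t. W t \<omega>) (E \<omega>) r D1 (\<lambda>\<epsilon> t. q \<epsilon> t \<omega>) (\<lambda>\<epsilon> t. sig \<epsilon> t \<omega>)"
    if "\<omega> \<in> space M" "\<forall>k. 1 \<le> k \<longrightarrow> (\<exists>t>0. E \<omega> t = real k * b)" for \<omega>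
    by unfold_locales (use that b T r D W_cont W_0 sol in \<open>auto simp: E_def\<close>)
  have bound: "AE \<omega> in M. ennreal ((err \<epsilon> \<omega>)\<^sup>2) \<le> ennreal (C\<^sup>2) * (1 + Z \<omega>)" if "0 < \<epsilon>" for \<epsilon>
  proof -
    have "AE \<omega> in M. Z \<omega> \<noteq> \<infinity>" using Z_fin by (intro nn_integral_PInf_AE) auto
    with hit AE_space show ?thesis
    proof eventually_elim
      case (elim \<omega>)
      interpret e: energy_path_family m b D0 T "\<lambda>t. W t \<omega>" "E \<omega>" r D1 "\<lambda>\<epsilon> t. q \<epsilon> t \<omega>" "\<lambda>\<epsilon> t. sig \<epsilon> t \<omega>"
        using elim(2,1) by (rule family)
      define z where "z = enn2real (Z \<omega>)"
      have z: "0 \<le> z" "Z \<omega> = ennreal z" using elim(3) by (auto simp: z_def less_top)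
      \<comment> \<open>Each normalised increment has eighth power at most \<open>z\<close>, so
        \<open>K\<close> dominates it, and the summand 1 ensures \<open>1 \<le> K\<close>. Squaring
        the bound \<open>C * K^4\<close> produces exactly C^2 (1 + Z).\<close>
      define K where "K = root 8 (1 + z)"
      have K8: "K^8 = 1 + z" unfolding K_def using z by (intro real_root_pow_pos2) auto
      have K1: "1 \<le> K" unfolding K_def using z by simp
      have "\<bar>W ((T + 1) * ((real j + 1) / 8^n)) \<omega> - W ((T + 1) * (real j / 8^n)) \<omega>\<bar> \<le> K / 2^n"
        if "j < 8^n" for n j
      proof -
        let ?x = "2^n * (W ((T + 1) * ((real j + 1) / 8^n)) \<omega> - W ((T + 1) * (real j / 8^n)) \<omega>)"
        have "?x^8 \<le> z" using Z[OF that, of \<omega>] z by simp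
        then have "\<bar>?x\<bar>^8 \<le> K^8" unfolding K8 by simp
        then have "\<bar>?x\<bar> \<le> K" using K1 by (subst (asm) power_mono_iff) auto
        then show ?thesis by (simp add: abs_mult le_divide_eq mult.commute)
      qed
      then have "\<bar>err \<epsilon> \<omega>\<bar> \<le> C * K^4"
        unfolding err_def C_def e.\<tau>_def[symmetric] using that m D \<phi> \<Phi> L K1
        by (intro e.pairing_error_le) auto
      then have "\<bar>err \<epsilon> \<omega>\<bar>^2 \<le> (C * K^4)^2" by (rule power_mono) simp
      also have "\<dots> = C\<^sup>2 * (1 + z)" unfolding K8[symmetric] by (simp add: power_mult_distrib)
      finally have "ennreal ((err \<epsilon> \<omega>)\<^sup>2) \<le> ennreal (C\<^sup>2 * (1 + z))" by (simp add: ennreal_leI)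
      also have "\<dots> = ennreal (C\<^sup>2) * (1 + Z \<omega>)" using z by (simp add: ennreal_mult)
      finally show ?case .
    qed
  qed
  \<comment> \<open>Dominated convergence works along sequences; as the majorant is the same for all
    \<epsilon>, every positive sequence tending to 0 is covered, and hence the one-sided
    limit.\<close>
  have "(\<lambda>n. \<integral>\<^sup>+ \<omega>. ennreal ((err (s n) \<omega>)\<^sup>2) \<partial>M) \<longlonglongrightarrow> 0"
    if s: "\<And>n. 0 < s n" "s \<longlonglongrightarrow> 0" for s :: "nat \<Rightarrow> real"
  proof (rule nn_integral_dominated_tendsto_0)
    show "(\<lambda>\<omega>. ennreal (C\<^sup>2) * (1 + Z \<omega>)) \<in> borel_measurable M" by measurable
    have "(\<integral>\<^sup>+\<omega>. ennreal (C\<^sup>2) * (1 + Z \<omega>) \<partial>M) = ennreal (C\<^sup>2) * (1 + (\<integral>\<^sup>+\<omega>. Z \<omega> \<partial>M))"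
      by (simp add: nn_integral_cmult nn_integral_add emeasure_space_1)
    also have "\<dots> < \<infinity>" using Z_fin by (simp add: ennreal_mult_less_top)
    finally show "(\<integral>\<^sup>+\<omega>. ennreal (C\<^sup>2) * (1 + Z \<omega>) \<partial>M) < \<infinity>" .
    show "AE \<omega> in M. ennreal ((err (s n) \<omega>)\<^sup>2) \<le> ennreal (C\<^sup>2) * (1 + Z \<omega>)" for n
      using s(1) by (rule bound)
    have s_lim: "filterlim s (at_right 0) sequentially"
      using s by (intro tendsto_imp_filterlim_at_right) auto
    show "AE \<omega> in M. (\<lambda>n. ennreal ((err (s n) \<omega>)\<^sup>2)) \<longlonglongrightarrow> 0"
      using hit cross E_T AE_space
    proof eventually_elim
      case (elim \<omega>)
      interpret e: energy_path_family m b D0 T "\<lambda>t. W t \<omega>" "E \<omega>" r D1 "\<lambda>\<epsilon> t. q \<epsilon> t \<omega>" "\<lambda>\<epsilon> t. sig \<epsilon> t \<omega>"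
        using elim(4,1) by (rule family)
      interpret e: generic_path_family m b D0 T "\<lambda>t. W t \<omega>" "E \<omega>" r D1 "\<lambda>\<epsilon> t. q \<epsilon> t \<omega>" "\<lambda>\<epsilon> t. sig \<epsilon> t \<omega>"
        by unfold_locales (use elim(2,3) in \<open>auto simp: e.\<tau>_def\<close>)
      have "((\<lambda>\<epsilon>. LBINT t:{0<..}. sig \<epsilon> t \<omega> * \<phi> t) \<longlongrightarrow>
          b * (\<Sum>i\<in>{1..count_hits (E \<omega>) b T}. \<phi> (hit_time (E \<omega>) (real i * b)))) (at_right 0)"
        using e.pairing_tendsto[of \<phi>] \<phi> by (simp add: e.\<tau>_def)
      from tendsto_diff[OF this tendsto_const[of "b * (\<Sum>i\<in>{1..count_hits (E \<omega>) b T}. \<phi> (hit_time (E \<omega>) (real i * b)))"]]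
      have "((\<lambda>\<epsilon>. err \<epsilon> \<omega>) \<longlongrightarrow> 0) (at_right 0)" by (simp add: err_def)
      from tendsto_power[OF filterlim_compose[OF this s_lim], of 2]
      have "(\<lambda>n. ennreal ((err (s n) \<omega>)\<^sup>2)) \<longlonglongrightarrow> ennreal 0" by (intro tendsto_ennrealI) simp
      then show ?case by simp
    qed
  qed
  then have "((\<lambda>\<epsilon>. \<integral>\<^sup>+ \<omega>. ennreal ((err \<epsilon> \<omega>)\<^sup>2) \<partial>M) \<longlongrightarrow> 0) (at_right 0)"
    by (intro tendsto_at_right_sequentially[of 0 1]) auto
  then show ?thesis by (simp only: err_def E_def[abs_def])
qed

end
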